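(* Let $0.01\le\varepsilon_1<\varepsilon_2\le0.49$ and let $k$ be an integer with $\varepsilon_2-\varepsilon_1\ge 2^{-O(k)}$. Then any $\left(k,\ k+\left\lfloor\frac{-\log(\varepsilon_2-\varepsilon_1)}{20}\right\rfloor,\ \varepsilon_1,\varepsilon_2\right)$-tolerant junta tester must make at least $\left(\frac{k}{-\log(\varepsilon_2-\varepsilon_1)}\right)^{-\Omega(\log(\varepsilon_2-\varepsilon_1))}$ queries.
   Context: A $k$-junta is a function $\{0,1\}^n\to\{0,1\}$ depending on at most $k$ variables. Distance between functions is the fraction of inputs on which they disagree; $\varepsilon$-close / $\varepsilon$-far from a class means distance to some member at most $\varepsilon$ / to every member at least $\varepsilon$. For $k\le k'$, a $(k,k',\varepsilon_1,\varepsilon_2)$-tolerant junta tester is a randomized (possibly adaptive) algorithm with query access to $f$ that accepts with probability at least $2/3$ if $f$ is $\varepsilon_1$-close to a $k$-junta and rejects with probability at least $2/3$ if $f$ is $\varepsilon_2$-far from all $k'$-juntas. $O,\Omega$ hide absolute constants; logarithms are base 2. *)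

theory Defs
  imports "HOL-Probability.Probability_Mass_Function"
begin

definition cube :: "nat \<Rightarrow> (nat \<Rightarrow> bool) set" where
  "cube n = {..<n} \<rightarrow>\<^sub>E UNIV"

text \<open>
  A Boolean function on the n-cube is a total function on \<open>nat \<Rightarrow> bool\<close>; every notion
  below depends only on its values on \<open>cube n\<close>.
\<close>

type_synonym boolfun = "(nat \<Rightarrow> bool) \<Rightarrow> bool"

definition junta :: "nat \<Rightarrow> nat \<Rightarrow> boolfun \<Rightarrow> bool" where
  "junta n k f \<longleftrightarrow>
     (\<exists>J\<subseteq>{..<n}. card J \<le> k \<and>
        (\<forall>x\<in>cube n. \<forall>y\<in>cube n. (\<forall>i\<in>J. x i = y i) \<longrightarrow> f x = f y))"

definition distance :: "nat \<Rightarrow> boolfun \<Rightarrow> boolfun \<Rightarrow> real" where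
  "distance n f g = real (card {x \<in> cube n. f x \<noteq> g x}) / real (card (cube n))"

definition close_to_junta :: "nat \<Rightarrow> nat \<Rightarrow> real \<Rightarrow> boolfun \<Rightarrow> bool" where
  "close_to_junta n k \<epsilon> f \<longleftrightarrow> (\<exists>g. junta n k g \<and> distance n f g \<le> \<epsilon>)"

definition far_from_juntas :: "nat \<Rightarrow> nat \<Rightarrow> real \<Rightarrow> boolfun \<Rightarrow> bool" where
  "far_from_juntas n k \<epsilon> f \<longleftrightarrow> (\<forall>g. junta n k g \<longrightarrow> \<epsilon> \<le> distance n f g)"

text \<open>
  A deterministic adaptive query algorithm is a finite decision tree: at \<open>Query x t u\<close> the
  value at \<open>x\<close> is requested, and the computation goes on with \<open>t\<close> if it is true and with
  \<open>u\<close> otherwise. A randomized algorithm is a probability distribution on such trees. There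
  are only countably many trees querying points of \<open>cube n\<close>, so discrete distributions
  lose no generality.
\<close>

datatype (queried: 'a) decision_tree =
    Verdict bool
  | Query 'a "'a decision_tree" "'a decision_tree"

primrec accepts :: "'a decision_tree \<Rightarrow> ('a \<Rightarrow> bool) \<Rightarrow> bool" where
  "accepts (Verdict b) f = b"
| "accepts (Query x t u) f = (if f x then accepts t f else accepts u f)"

primrec num_queries :: "'a decision_tree \<Rightarrow> ('a \<Rightarrow> bool) \<Rightarrow> nat" where
  "num_queries (Verdict b) f = 0"
| "num_queries (Query x t u) f = Suc (if f x then num_queries t f else num_queries u f)"

definition tolerant_junta_tester ::
  "nat \<Rightarrow> nat \<Rightarrow> nat \<Rightarrow> real \<Rightarrow> real \<Rightarrow> (nat \<Rightarrow> bool) decision_tree pmf \<Rightarrow> bool" where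
  "tolerant_junta_tester n k k' \<epsilon>\<^sub>1 \<epsilon>\<^sub>2 T \<longleftrightarrow>
     k \<le> k' \<and>
     (\<forall>t\<in>set_pmf T. queried t \<subseteq> cube n) \<and>
     (\<forall>f. close_to_junta n k \<epsilon>\<^sub>1 f \<longrightarrow> measure_pmf.prob T {t. accepts t f} \<ge> 2 / 3) \<and>
     (\<forall>f. far_from_juntas n k' \<epsilon>\<^sub>2 f \<longrightarrow> measure_pmf.prob T {t. \<not> accepts t f} \<ge> 2 / 3)"

text \<open>Worst-case query complexity, over the input function and the internal randomness.\<close>

definition makes_at_least_queries :: "'a decision_tree pmf \<Rightarrow> real \<Rightarrow> bool" where
  "makes_at_least_queries T q \<longleftrightarrow> (\<exists>t\<in>set_pmf T. \<exists>f. q \<le> real (num_queries t f))"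

end

theory Submission imports Defs "HOL-Probability.Hoeffding" begin

text \<open>
  Points of the cube on \<open>m = k + r\<close> coordinates are identified with subsets of \<open>{..<m}\<close>. The first
  \<open>a\<close> coordinates are public: all functions vanish unless the public part lies in a fixed family
  \<open>P\<close>, which scales all distances by \<open>card P / 2 ^ a\<close>. On the remaining (active) points a
  "no" function is uniformly random, hence far from all juntas by a Chernoff and a union bound.

  A "yes" function has a hidden random set \<open>R\<close> of \<open>r\<close> non-public coordinates and a code \<open>\<K>\<close> of
  minimum distance \<open>d\<close> on \<open>R\<close>, closed under complement. On each fibre over the coordinates outside
  \<open>R\<close> it is constant on \<open>\<K>\<close>, random off \<open>\<K>\<close>, and takes opposite values at antipodal points off
  \<open>\<K>\<close>. The antipodal pairs balance exactly, so the value on \<open>\<K>\<close> is a junta on the complement of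
  \<open>R\<close> with a deterministic advantage proportional to the density of \<open>\<K>\<close>; by the greedy bound the
  code is dense enough for this advantage to exceed that of every junta against a random function.

  The two kinds of functions can be told apart only by querying two points whose difference is
  contained in \<open>R\<close> and has at least \<open>d\<close> elements, and a given pair has this property with probability
  at most \<open>(r / (m - a)) ^ d\<close>. For gaps \<open>\<epsilon>\<^sub>2 - \<epsilon>\<^sub>1\<close> that are not small, \<open>\<K>\<close> consists of all
  subsets of \<open>R\<close>, so that "yes" functions are genuine juntas.
\<close>

section \<open>Subsets of a finite set and antipodal codes\<close>

lemma card_supersets_of_size:
  assumes "finite H" "D \<subseteq> H" "card D \<le> r"
  shows "card {R. R \<subseteq> H \<and> card R = r \<and> D \<subseteq> R} = (card H - card D) choose (r - card D)"
proof -
  have fD: "finite D" using assms finite_subset by blast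
  have "bij_betw (\<lambda>R. R - D) {R. R \<subseteq> H \<and> card R = r \<and> D \<subseteq> R}
          {E. E \<subseteq> H - D \<and> card E = r - card D}"
  proof (rule bij_betwI[where g = "\<lambda>E. E \<union> D"])
    show "(\<lambda>R. R - D) \<in> {R. R \<subseteq> H \<and> card R = r \<and> D \<subseteq> R} \<rightarrow> {E. E \<subseteq> H - D \<and> card E = r - card D}"
      using fD by (auto simp: card_Diff_subset)
    show "(\<lambda>E. E \<union> D) \<in> {E. E \<subseteq> H - D \<and> card E = r - card D} \<rightarrow> {R. R \<subseteq> H \<and> card R = r \<and> D \<subseteq> R}"
    proof
      fix E assume E: "E \<in> {E. E \<subseteq> H - D \<and> card E = r - card D}"
      then have "finite E" using assms(1) by (auto intro: finite_subset)
      moreover have "E \<inter> D = {}" using E by auto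
      ultimately have "card (E \<union> D) = r" using E fD assms(3) by (simp add: card_Un_disjoint)
      then show "E \<union> D \<in> {R. R \<subseteq> H \<and> card R = r \<and> D \<subseteq> R}" using E assms(2) by auto
    qed
  qed auto
  then have "card {R. R \<subseteq> H \<and> card R = r \<and> D \<subseteq> R} = card {E. E \<subseteq> H - D \<and> card E = r - card D}"
    by (rule bij_betw_same_card)
  also have "\<dots> = card (H - D) choose (r - card D)"
    using assms by (intro n_subsets) auto
  also have "card (H - D) = card H - card D" using assms fD by (simp add: card_Diff_subset)
  finally show ?thesis .
qed

text \<open>The quotient of the two binomials is a product of factors
  \<open>(r - i) / (h - i)\<close> with \<open>i < d\<close>, each at most \<open>r / h\<close>; the
  induction adds one factor. Denominators are cleared to stay within \<open>nat\<close>.\<close>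

lemma binomial_diff_mult_power_le:
  assumes "d \<le> r" "r \<le> h"
  shows "((h - d) choose (r - d)) * h ^ d \<le> r ^ d * (h choose r)"
  using assms(1)
proof (induction d)
  case (Suc d)
  let ?B = "(h - d) choose (r - d)" and ?B' = "(h - Suc d) choose (r - Suc d)"
  have "h - d = Suc (h - Suc d)" "r - d = Suc (r - Suc d)" using Suc.prems assms(2) by auto
  then have absorb: "(r - d) * ?B = (h - d) * ?B'"
    by (metis Suc_times_binomial_eq mult.commute)
  have "d * r \<le> d * h" using assms(2) by simp
  then have rh: "(r - d) * h \<le> r * (h - d)"
    using diff_le_mono2[of "d * r" "d * h" "r * h"]
    by (simp only: diff_mult_distrib diff_mult_distrib2 mult.commute[of r d])
  have "(h - d) * (?B' * h ^ Suc d) = (r - d) * h * (?B * h ^ d)"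
    using absorb by (metis mult.assoc mult.left_commute power_Suc)
  also have "\<dots> \<le> r * (h - d) * (r ^ d * (h choose r))"
    using Suc.IH Suc.prems by (intro mult_le_mono[OF rh]) simp
  also have "\<dots> = (h - d) * (r ^ Suc d * (h choose r))" by simp
  finally show ?case using Suc.prems assms(2) by simp
qed simp

text \<open>In terms of a random hidden set: a uniform \<open>r\<close>-subset of \<open>H\<close>
  contains \<open>D\<close> with probability at most \<open>(r / card H) ^ d\<close>. Shrinking
  \<open>D\<close> to \<open>d\<close> elements only increases the count.\<close>

lemma card_supersets_of_size_le:
  assumes "finite H" "D \<subseteq> H" "d \<le> card D" "d \<le> r" "r \<le> card H"
  shows "card {R. R \<subseteq> H \<and> card R = r \<and> D \<subseteq> R} * card H ^ d \<le> r ^ d * (card H choose r)"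
proof -
  obtain D' where D': "D' \<subseteq> D" "card D' = d" "finite D'"
    using assms(3) by (meson obtain_subset_with_card_n)
  have "card {R. R \<subseteq> H \<and> card R = r \<and> D \<subseteq> R} \<le> card {R. R \<subseteq> H \<and> card R = r \<and> D' \<subseteq> R}"
    using D' assms(1) by (intro card_mono) auto
  also have "\<dots> = (card H - d) choose (r - d)"
    using card_supersets_of_size[OF assms(1), of D' r] D' assms by auto
  finally have "card {R. R \<subseteq> H \<and> card R = r \<and> D \<subseteq> R} * card H ^ d
      \<le> ((card H - d) choose (r - d)) * card H ^ d" by simp
  also have "\<dots> \<le> r ^ d * (card H choose r)"
    using assms by (intro binomial_diff_mult_power_le)
  finally show ?thesis .
qed

lemma card_hamming_ball_le:
  assumes "finite R" "A \<subseteq> R"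
  shows "card {B. B \<subseteq> R \<and> card (sym_diff A B) < d} \<le> (\<Sum>i<d. card R choose i)"
proof -
  have "inj_on (\<lambda>B. sym_diff A B) {B. B \<subseteq> R \<and> card (sym_diff A B) < d}"
    by (rule inj_on_inverseI[where g = "\<lambda>B. sym_diff A B"]) auto
  then have "card {B. B \<subseteq> R \<and> card (sym_diff A B) < d}
      = card ((\<lambda>B. sym_diff A B) ` {B. B \<subseteq> R \<and> card (sym_diff A B) < d})"
    by (simp add: card_image)
  also have "\<dots> \<le> card (\<Union>i<d. {E. E \<subseteq> R \<and> card E = i})"
    using assms by (intro card_mono) auto
  also have "\<dots> \<le> (\<Sum>i<d. card {E. E \<subseteq> R \<and> card E = i})"
    by (rule card_UN_le) simp
  also have "\<dots> = (\<Sum>i<d. card R choose i)"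
    using assms by (simp add: n_subsets)
  finally show ?thesis .
qed

text \<open>The distance \<open>d\<close> separates points of one fibre that will share a value;
  closure under complement lets the antipodal map of \<open>Pow R\<close> preserve the code, and
  hence also its complement.\<close>

definition antipodal_code :: "'a set \<Rightarrow> nat \<Rightarrow> 'a set set \<Rightarrow> bool" where
  "antipodal_code R d \<K> \<longleftrightarrow> \<K> \<subseteq> Pow R \<and> (\<forall>A\<in>\<K>. R - A \<in> \<K>) \<and>
     (\<forall>A\<in>\<K>. \<forall>B\<in>\<K>. A \<noteq> B \<longrightarrow> d \<le> card (sym_diff A B))"

text \<open>Greedy argument for a code of maximal size. If \<open>B\<close> were at distance at
  least \<open>d\<close> from all codewords, so would be \<open>R - B\<close>, by closure under
  complement; these two are at distance \<open>card R\<close> from each other, so both could be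
  added. Hence the balls of radius \<open>d - 1\<close> around the codewords cover
  \<open>Pow R\<close>.\<close>

lemma antipodal_gilbert_varshamov:
  assumes "finite R" "0 < d" "d \<le> card R"
  shows "\<exists>\<K>. antipodal_code R d \<K> \<and> 2 ^ card R \<le> card \<K> * (\<Sum>i<d. card R choose i)"
proof -
  have fin: "finite {\<K>. antipodal_code R d \<K>}"
    by (rule finite_subset[of _ "Pow (Pow R)"]) (use assms in \<open>auto simp: antipodal_code_def\<close>)
  have "antipodal_code R d {}" by (simp add: antipodal_code_def)
  then have "Max (card ` {\<K>. antipodal_code R d \<K>}) \<in> card ` {\<K>. antipodal_code R d \<K>}"
    using fin by (intro Max_in) auto
  then obtain \<K> where \<K>: "antipodal_code R d \<K>"
    and K_max: "Max (card ` {\<K>. antipodal_code R d \<K>}) = card \<K>"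
    by auto
  have max: "card \<L> \<le> card \<K>" if "antipodal_code R d \<L>" for \<L>
    unfolding K_max[symmetric] using that fin by (intro Max_ge) auto
  have sub: "\<K> \<subseteq> Pow R" using \<K> by (simp add: antipodal_code_def)
  then have fK: "finite \<K>" using assms(1) finite_subset by blast
  have cover: "\<exists>A\<in>\<K>. card (sym_diff A B) < d" if B: "B \<subseteq> R" for B
  proof (rule ccontr)
    assume "\<not> ?thesis"
    then have far: "d \<le> card (sym_diff A B)" if "A \<in> \<K>" for A using that by (meson not_less)
    have far': "d \<le> card (sym_diff A (R - B))" if A: "A \<in> \<K>" for A
    proof -
      have "sym_diff A (R - B) = sym_diff (R - A) B" using sub A B by auto
      then show ?thesis using far[of "R - A"] \<K> A by (auto simp: antipodal_code_def)
    qed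
    have BR: "sym_diff B (R - B) = R" "sym_diff (R - B) B = R" using B by auto
    have sym: "sym_diff X Y = sym_diff Y X" for X Y :: "'a set" by auto
    have notin: "B \<notin> \<K>" using far[of B] assms(2) by auto
    have "antipodal_code R d (insert B (insert (R - B) \<K>))"
      unfolding antipodal_code_def
    proof (intro conjI ballI impI)
      show "insert B (insert (R - B) \<K>) \<subseteq> Pow R" using sub B by auto
    next
      fix A assume "A \<in> insert B (insert (R - B) \<K>)"
      then show "R - A \<in> insert B (insert (R - B) \<K>)"
        using \<K> B by (auto simp: antipodal_code_def double_diff)
    next
      fix A C assume "A \<in> insert B (insert (R - B) \<K>)" "C \<in> insert B (insert (R - B) \<K>)" "A \<noteq> C"
      then show "d \<le> card (sym_diff A C)"
        using \<K> far far' BR assms(3) far[of C] far'[of C] sym[of B C] sym[of "R - B" C]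
        unfolding antipodal_code_def by (elim insertE) auto
    qed
    from max[OF this] have "card (insert B (insert (R - B) \<K>)) \<le> card \<K>" .
    moreover have "card (insert B \<K>) \<le> card (insert B (insert (R - B) \<K>))"
      using fK by (intro card_mono) auto
    ultimately show False using notin fK by simp
  qed
  have "2 ^ card R = card (Pow R)" using assms(1) by (simp add: card_Pow)
  also have "\<dots> \<le> card (\<Union>A\<in>\<K>. {B. B \<subseteq> R \<and> card (sym_diff A B) < d})"
    using cover fK assms(1) by (intro card_mono) auto
  also have "\<dots> \<le> (\<Sum>A\<in>\<K>. card {B. B \<subseteq> R \<and> card (sym_diff A B) < d})"
    by (rule card_UN_le[OF fK])
  also have "\<dots> \<le> (\<Sum>A\<in>\<K>. \<Sum>i<d. card R choose i)"
    using sub assms(1) by (intro sum_mono card_hamming_ball_le) auto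
  finally show ?thesis using \<K> by auto
qed

text \<open>For \<open>x \<le> 1\<close> each \<open>x ^ d\<close> may be raised to
  \<open>x ^ i\<close>, after which the sum is part of the binomial expansion.\<close>

lemma sum_binomial_mult_power_le:
  fixes x :: real
  assumes "0 \<le> x" "x \<le> 1"
  shows "real (\<Sum>i<d. r choose i) * x ^ d \<le> (1 + x) ^ r"
proof -
  have "real (\<Sum>i<d. r choose i) * x ^ d = (\<Sum>i<d. real (r choose i) * x ^ d)"
    by (simp add: sum_distrib_right)
  also have "\<dots> \<le> (\<Sum>i<d. real (r choose i) * x ^ i)"
    using assms by (intro sum_mono mult_left_mono power_decreasing) auto
  \<comment> \<open>The range \<open>max d (Suc r)\<close> is needed because \<open>d\<close> may
    exceed \<open>r\<close>; binomials beyond \<open>r\<close> vanish.\<close>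
  also have "\<dots> \<le> (\<Sum>i<max d (Suc r). real (r choose i) * x ^ i)"
    using assms by (intro sum_mono2) auto
  also have "\<dots> = (\<Sum>i\<le>r. real (r choose i) * x ^ i)"
    by (intro sum.mono_neutral_right) auto
  also have "\<dots> = (1 + x) ^ r"
    using binomial_ring[of x 1 r] by (simp add: add.commute)
  finally show ?thesis .
qed

text \<open>With length \<open>4 * b\<close> and distance \<open>b div 15\<close>, a greedy code
  thus has density at least \<open>1 / 2 ^ b\<close>. The weight is \<open>x = 1 / 8\<close>; fifth
  powers are compared because \<open>(9 / 8) ^ 5 \<le> 2\<close> and
  \<open>15 * (b div 15) \<le> b\<close>.\<close>

lemma sum_binomial_le_two_power:
  "(\<Sum>i<b div 15. 4 * b choose i) \<le> 2 ^ b"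
proof -
  let ?d = "b div 15" and ?V = "\<Sum>i<b div 15. 4 * b choose i"
  have "real ?V * (1 / 8) ^ ?d \<le> (1 + 1 / 8) ^ (4 * b)"
    by (rule sum_binomial_mult_power_le) auto
  then have "real ?V \<le> (9 / 8) ^ (4 * b) * 8 ^ ?d"
    by (simp add: field_simps power_divide)
  then have "real ?V ^ 5 \<le> ((9 / 8) ^ (4 * b) * 8 ^ ?d) ^ 5"
    by (intro power_mono) (auto intro: sum_nonneg)
  also have "\<dots> = ((9 / 8) ^ 5) ^ (4 * b) * 2 ^ (15 * ?d)"
  proof -
    have "(2::real) ^ (15 * ?d) = (2 ^ 3) ^ (5 * ?d)" by (simp only: power_mult[symmetric]) simp
    then show ?thesis by (simp add: power_mult_distrib mult.commute flip: power_mult)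
  qed
  also have "\<dots> \<le> 2 ^ (4 * b) * 2 ^ b"
    by (intro mult_mono power_mono power_increasing) (auto simp: field_simps)
  also have "\<dots> = ((2::real) ^ b) ^ 5" by (simp flip: power_mult power_add)
  finally have "real ?V \<le> 2 ^ b"
    by (rule power_le_imp_le_base[of _ 4, simplified]) auto
  then show ?thesis by (metis of_nat_le_iff of_nat_numeral of_nat_power)
qed

section \<open>Decision trees on random functions\<close>

primrec query_path :: "'a decision_tree \<Rightarrow> ('a \<Rightarrow> bool) \<Rightarrow> 'a set" where
  "query_path (Verdict b) f = {}"
| "query_path (Query x t u) f = insert x (if f x then query_path t f else query_path u f)"

lemma finite_query_path [simp]: "finite (query_path t f)"
  by (induction t) auto

lemma card_query_path_le: "card (query_path t f) \<le> num_queries t f"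
  by (induction t) (auto intro: card_insert_le_m1 order.trans[OF card_insert_le_m1] simp: card_insert_if)

lemma accepts_map_decision_tree [simp]:
  "accepts (map_decision_tree \<pi> t) f = accepts t (\<lambda>x. f (\<pi> x))"
  by (induction t) auto

lemma num_queries_map_decision_tree [simp]:
  "num_queries (map_decision_tree \<pi> t) f = num_queries t (\<lambda>x. f (\<pi> x))"
  by (induction t) auto

lemma card_PiE_bool_fixed:
  assumes "finite S" "Q \<subseteq> S"
  shows "card {F \<in> S \<rightarrow>\<^sub>E (UNIV :: bool set). \<forall>x\<in>Q. F x = v x} = 2 ^ (card S - card Q)"
proof -
  have "{F \<in> S \<rightarrow>\<^sub>E (UNIV :: bool set). \<forall>x\<in>Q. F x = v x} = (\<Pi>\<^sub>E x\<in>S. if x \<in> Q then {v x} else UNIV)"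
    using assms(2) by (auto simp: PiE_iff extensional_def split: if_splits)
  also have "card \<dots> = (\<Prod>x\<in>S. if x \<in> Q then 1 else 2)"
    using assms(1) by (subst card_PiE) (auto intro!: prod.cong)
  also have "\<dots> = 2 ^ card (S - Q)"
    using assms(1) by (simp add: prod.If_cases Diff_eq)
  also have "card (S - Q) = card S - card Q"
    using assms by (intro card_Diff_subset) (auto intro: finite_subset)
  finally show ?thesis .
qed

definition masked :: "('a \<Rightarrow> bool) \<Rightarrow> ('a \<Rightarrow> bool) \<Rightarrow> 'a \<Rightarrow> bool" where
  "masked act F x \<longleftrightarrow> act x \<and> F x"

text \<open>With \<open>F\<close> uniformly random, \<open>masked\<close> is the "no" function and
  \<open>planted\<close> the "yes" function. Points with the same image under \<open>\<rho>\<close>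
  share one random bit, up to the fixed sign \<open>s\<close>.\<close>

definition planted :: "('a \<Rightarrow> bool) \<Rightarrow> ('a \<Rightarrow> 'a) \<Rightarrow> ('a \<Rightarrow> bool) \<Rightarrow> ('a \<Rightarrow> bool) \<Rightarrow> 'a \<Rightarrow> bool" where
  "planted act \<rho> s F x \<longleftrightarrow> act x \<and> (F (\<rho> x) \<noteq> s x)"

text \<open>
  The answers seen so far are recorded in \<open>C\<close>. As long as \<open>\<rho>\<close> is injective on the queried
  points, every answer pattern is equally likely for the masked and for the planted function.
\<close>

lemma card_rejecting_masked_le_planted_aux:
  fixes t :: "'a decision_tree"
  assumes S: "finite S" "\<rho> ` S \<subseteq> S" and "queried t \<subseteq> S" "fst ` C \<subseteq> S"
  shows "card {F \<in> S \<rightarrow>\<^sub>E UNIV. (\<forall>(x, \<beta>)\<in>C. F x = \<beta>) \<and> \<not> accepts t (masked act F) \<and>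
                inj_on \<rho> (fst ` C \<union> query_path t (masked act F))}
       \<le> card {F \<in> S \<rightarrow>\<^sub>E UNIV. (\<forall>(x, \<beta>)\<in>C. (F (\<rho> x) \<noteq> s x) = \<beta>) \<and>
                \<not> accepts t (planted act \<rho> s F)}"
  using assms(3,4)
proof (induction t arbitrary: C)
  case (Verdict b)
  let ?N = "{F \<in> S \<rightarrow>\<^sub>E UNIV. (\<forall>(x, \<beta>)\<in>C. F x = \<beta>)}"
  let ?Y = "{F \<in> S \<rightarrow>\<^sub>E UNIV. (\<forall>(x, \<beta>)\<in>C. (F (\<rho> x) \<noteq> s x) = \<beta>)}"
  show ?case
  \<comment> \<open>The record may be contradictory, when a point is queried twice; then the left
    set is empty.\<close>
  proof (cases "\<not> b \<and> inj_on \<rho> (fst ` C) \<and> ?N \<noteq> {}")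
    case True
    then obtain v where "v \<in> ?N" by (elim conjE) (erule ex_in_conv[THEN iffD2, THEN exE], rule that)
    then have v: "v (fst c) = snd c" if "c \<in> C" for c using that by auto
    have C_iff: "(\<forall>(x, \<beta>)\<in>C. G x = \<beta>) \<longleftrightarrow> (\<forall>x\<in>fst ` C. G x = v x)" for G
      by (simp add: case_prod_beta v cong: ball_cong)
    let ?Q = "fst ` C"
    \<comment> \<open>The value at \<open>\<rho> x\<close> has to be \<open>v x\<close> flipped by
      \<open>s x\<close>. Injectivity makes this a consistent prescription on the image, so both
      sides fix equally many values of \<open>F\<close>.\<close>
    define w where "w y = (v (inv_into ?Q \<rho> y) \<noteq> s (inv_into ?Q \<rho> y))" for y
    have w: "w (\<rho> x) = (v x \<noteq> s x)" if "x \<in> ?Q" for x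
      using that True by (simp add: w_def)
    have "?N = {F \<in> S \<rightarrow>\<^sub>E UNIV. \<forall>x\<in>?Q. F x = v x}" by (simp only: C_iff)
    moreover have "?Y = {F \<in> S \<rightarrow>\<^sub>E UNIV. \<forall>y\<in>\<rho> ` ?Q. F y = w y}"
      unfolding C_iff by (auto simp: w)
    moreover have "card (\<rho> ` ?Q) = card ?Q" using True by (simp add: card_image)
    moreover have "\<rho> ` ?Q \<subseteq> S" using S(2) Verdict.prems by auto
    ultimately have "card ?N = card ?Y"
      using card_PiE_bool_fixed[OF S(1), of ?Q v] card_PiE_bool_fixed[OF S(1), of "\<rho> ` ?Q" w]
        Verdict.prems by simp
    then show ?thesis using True by simp
  next
    case False
    then have "{F \<in> S \<rightarrow>\<^sub>E UNIV. (\<forall>(x, \<beta>)\<in>C. F x = \<beta>) \<and> \<not> accepts (Verdict b) (masked act F) \<and>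
                inj_on \<rho> (fst ` C \<union> query_path (Verdict b) (masked act F))} = {}" by auto
    then show ?thesis by (simp only: card.empty)
  qed
next
  case (Query x t u)
  have fin: "finite (S \<rightarrow>\<^sub>E (UNIV :: bool set))" using S(1) by (intro finite_PiE) auto
  let ?N = "\<lambda>t C. {F \<in> S \<rightarrow>\<^sub>E UNIV. (\<forall>(x, \<beta>)\<in>C. F x = \<beta>) \<and> \<not> accepts t (masked act F) \<and>
                inj_on \<rho> (fst ` C \<union> query_path t (masked act F))}"
  let ?Y = "\<lambda>t C. {F \<in> S \<rightarrow>\<^sub>E UNIV. (\<forall>(x, \<beta>)\<in>C. (F (\<rho> x) \<noteq> s x) = \<beta>) \<and>
                \<not> accepts t (planted act \<rho> s F)}"
  have finY: "finite (?Y t C)" for t C using fin by simp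
  show ?case
  proof (cases "act x")
    case True
    have "card (?N (Query x t u) C) \<le> card (?N t (insert (x, True) C) \<union> ?N u (insert (x, False) C))"
      using True fin by (intro card_mono) (auto simp: masked_def split: if_splits)
    also have "\<dots> \<le> card (?N t (insert (x, True) C)) + card (?N u (insert (x, False) C))"
      by (rule card_Un_le)
    also have "\<dots> \<le> card (?Y t (insert (x, True) C)) + card (?Y u (insert (x, False) C))"
      using Query.prems by (intro add_mono Query.IH) auto
    \<comment> \<open>The two events are disjoint because they prescribe opposite answers at
      \<open>x\<close>.\<close>
    also have "\<dots> = card (?Y t (insert (x, True) C) \<union> ?Y u (insert (x, False) C))"
      by (rule card_Un_disjoint[OF finY finY, symmetric]) auto
    also have "\<dots> \<le> card (?Y (Query x t u) C)"
      using True by (intro card_mono finY) (auto simp: planted_def)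
    finally show ?thesis .
  next
    case False
    \<comment> \<open>An inactive point is answered \<open>False\<close> by both functions, so
      nothing is recorded, and dropping it only weakens the injectivity condition.\<close>
    have "card (?N (Query x t u) C) \<le> card (?N u C)"
      using False fin by (intro card_mono) (auto simp: masked_def intro: inj_on_subset)
    also have "\<dots> \<le> card (?Y u C)" using Query.prems by (intro Query.IH) auto
    also have "?Y u C = ?Y (Query x t u) C" using False by (simp add: planted_def)
    finally show ?thesis .
  qed
qed

lemma card_rejecting_masked_le_planted:
  assumes "finite S" "\<rho> ` S \<subseteq> S" "queried t \<subseteq> S"
  shows "card {F \<in> S \<rightarrow>\<^sub>E UNIV. \<not> accepts t (masked act F) \<and> inj_on \<rho> (query_path t (masked act F))}
       \<le> card {F \<in> S \<rightarrow>\<^sub>E UNIV. \<not> accepts t (planted act \<rho> s F)}"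
  using card_rejecting_masked_le_planted_aux[OF assms, of "{}"] by simp

text \<open>A Chernoff bound by exponential moments: the sum over \<open>F\<close> of
  \<open>exp (- 4 * \<tau> * N)\<close>, with \<open>N\<close> the number of disagreements, factors
  over the points, with factor \<open>1 + y\<close> inside \<open>A\<close> and \<open>2\<close>
  outside. Hoeffding's lemma for a fair coin bounds \<open>(1 + y) / 2\<close>.\<close>

lemma card_PiE_few_disagreements_le:
  fixes \<tau> :: real
  assumes S: "finite S" "A \<subseteq> S" and "\<tau> \<ge> 0"
  shows "card {F \<in> S \<rightarrow>\<^sub>E (UNIV :: bool set). card {x \<in> A. F x \<noteq> g x} < (1 / 2 - \<tau>) * card A}
           \<le> 2 ^ card S * exp (- 2 * \<tau>\<^sup>2 * card A)"
proof -
  let ?\<Omega> = "S \<rightarrow>\<^sub>E (UNIV :: bool set)" and ?M = "real (card A)"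
  let ?B = "{F \<in> ?\<Omega>. card {x \<in> A. F x \<noteq> g x} < (1 / 2 - \<tau>) * card A}"
  \<comment> \<open>With parameter \<open>\<lambda>\<close> the exponent per point of
    \<open>A\<close> is \<open>\<lambda>\<^sup>2 / 8 - \<lambda> * \<tau>\<close>, which is minimal
    at \<open>\<lambda> = 4 * \<tau>\<close>.\<close>
  define y where "y = exp (- 4 * \<tau>)"
  have fA: "finite A" using S finite_subset by blast
  have fin: "finite ?\<Omega>" using S by (intro finite_PiE) auto
  have weight: "(\<Prod>x\<in>S. if x \<in> A \<and> F x \<noteq> g x then y else 1) = exp (- 4 * \<tau> * card {x \<in> A. F x \<noteq> g x})" for F
  proof -
    have "(\<Prod>x\<in>S. if x \<in> A \<and> F x \<noteq> g x then y else 1) = y ^ card {x \<in> A. F x \<noteq> g x}"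
    proof -
      have "S \<inter> {x. x \<in> A \<and> F x \<noteq> g x} = {x \<in> A. F x \<noteq> g x}" using S(2) by auto
      then show ?thesis using S(1) by (simp add: prod.If_cases)
    qed
    then show ?thesis by (simp add: y_def exp_of_nat_mult[symmetric] mult.commute)
  qed
  have "-(4 * \<tau>) * (1 / 2) + ln (1 + 1 / 2 * (exp (4 * \<tau>) - 1)) \<le> (4 * \<tau>)\<^sup>2 / 8"
    using Hoeffdings_lemma_aux[of "4 * \<tau>" "1 / 2"] assms(3) by simp
  then have "ln ((1 + exp (4 * \<tau>)) / 2) \<le> 2 * \<tau> + 2 * \<tau>\<^sup>2"
    by (simp add: field_simps power2_eq_square)
  then have "(1 + exp (4 * \<tau>)) / 2 \<le> exp (2 * \<tau> + 2 * \<tau>\<^sup>2)"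
    by (metis add_pos_pos divide_pos_pos exp_gt_zero exp_le_cancel_iff exp_ln zero_less_numeral zero_less_one)
  then have "((1 + exp (4 * \<tau>)) / 2) * y \<le> exp (2 * \<tau> + 2 * \<tau>\<^sup>2) * y"
    by (intro mult_right_mono) (auto simp: y_def)
  then have y1: "1 + y \<le> 2 * exp (2 * \<tau>\<^sup>2 - 2 * \<tau>)"
    by (simp add: y_def field_simps flip: exp_add)
  have "card ?B * exp (- 4 * \<tau> * ((1 / 2 - \<tau>) * ?M)) = (\<Sum>F\<in>?B. exp (- 4 * \<tau> * ((1 / 2 - \<tau>) * ?M)))"
    by simp
  also have "\<dots> \<le> (\<Sum>F\<in>?B. exp (- 4 * \<tau> * card {x \<in> A. F x \<noteq> g x}))"
    using assms(3) by (intro sum_mono) (auto intro!: mult_left_mono)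
  also have "\<dots> \<le> (\<Sum>F\<in>?\<Omega>. exp (- 4 * \<tau> * card {x \<in> A. F x \<noteq> g x}))"
    using fin by (intro sum_mono2) auto
  also have "\<dots> = (\<Sum>F\<in>?\<Omega>. \<Prod>x\<in>S. if x \<in> A \<and> F x \<noteq> g x then y else 1)"
    by (simp only: weight)
  also have "\<dots> = (\<Prod>x\<in>S. \<Sum>\<beta>\<in>UNIV. if x \<in> A \<and> \<beta> \<noteq> g x then y else 1)"
    using S(1) by (subst prod_sum_PiE) auto
  also have "\<dots> = (\<Prod>x\<in>S. if x \<in> A then 1 + y else 2)"
    by (intro prod.cong) (auto simp: UNIV_bool)
  also have "\<dots> = (1 + y) ^ card A * 2 ^ card (S - A)"
  proof -
    have "S \<inter> {x. x \<in> A} = A" "S \<inter> - {x. x \<in> A} = S - A" using S(2) by auto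
    then show ?thesis using S(1) by (simp add: prod.If_cases)
  qed
  also have "\<dots> \<le> (2 * exp (2 * \<tau>\<^sup>2 - 2 * \<tau>)) ^ card A * 2 ^ card (S - A)"
    using y1 by (intro mult_right_mono power_mono) (auto simp: y_def add_nonneg_nonneg)
  also have "\<dots> = 2 ^ (card A + card (S - A)) * exp ((2 * \<tau>\<^sup>2 - 2 * \<tau>) * ?M)"
    by (simp add: power_mult_distrib power_add mult.commute flip: exp_of_nat_mult)
  also have "card A + card (S - A) = card S"
    using S fA by (metis card_Diff_subset card_mono le_add_diff_inverse)
  finally have "card ?B \<le> 2 ^ card S * exp ((2 * \<tau>\<^sup>2 - 2 * \<tau>) * ?M) / exp (- 4 * \<tau> * ((1 / 2 - \<tau>) * ?M))"
    by (simp add: pos_le_divide_eq)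
  also have "\<dots> = 2 ^ card S * exp ((2 * \<tau>\<^sup>2 - 2 * \<tau>) * ?M - (- 4 * \<tau> * ((1 / 2 - \<tau>) * ?M)))"
    by (simp only: exp_diff times_divide_eq_right)
  also have "(2 * \<tau>\<^sup>2 - 2 * \<tau>) * ?M - (- 4 * \<tau> * ((1 / 2 - \<tau>) * ?M)) = - 2 * \<tau>\<^sup>2 * ?M"
    by (simp add: algebra_simps power2_eq_square)
  finally show ?thesis .
qed

section \<open>Juntas on the cube\<close>

text \<open>Forgetting the coordinates from \<open>m\<close> on turns functions on
  \<open>Pow {..<m}\<close> into functions on \<open>cube n\<close>, so a construction of fixed size
  serves all large \<open>n\<close>.\<close>

definition support :: "nat \<Rightarrow> (nat \<Rightarrow> bool) \<Rightarrow> nat set" where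
  "support m x = {i. i < m \<and> x i}"

lemma card_cube: "card (cube n) = 2 ^ n"
  by (simp add: cube_def card_PiE)

lemma bij_betw_cube:
  assumes "m \<le> n"
  shows "bij_betw (\<lambda>(X, Z). restrict (\<lambda>i. i \<in> X \<union> Z) {..<n}) (Pow {..<m} \<times> Pow {m..<n}) (cube n)"
proof (rule bij_betwI[where g = "\<lambda>x. (support m x, {i \<in> {m..<n}. x i})"])
  show "(\<lambda>(X, Z). restrict (\<lambda>i. i \<in> X \<union> Z) {..<n}) \<in> Pow {..<m} \<times> Pow {m..<n} \<rightarrow> cube n"
    by (auto simp: cube_def)
  show "(\<lambda>x. (support m x, {i \<in> {m..<n}. x i})) \<in> cube n \<rightarrow> Pow {..<m} \<times> Pow {m..<n}"
    by (auto simp: support_def)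
next
  fix p assume "p \<in> Pow {..<m} \<times> Pow {m..<n}"
  then show "(support m ((\<lambda>(X, Z). restrict (\<lambda>i. i \<in> X \<union> Z) {..<n}) p),
      {i \<in> {m..<n}. (\<lambda>(X, Z). restrict (\<lambda>i. i \<in> X \<union> Z) {..<n}) p i}) = p"
    using assms by (cases p) (auto simp: support_def)
next
  fix x assume "x \<in> cube n"
  then show "(\<lambda>(X, Z). restrict (\<lambda>i. i \<in> X \<union> Z) {..<n}) (support m x, {i \<in> {m..<n}. x i}) = x"
    using assms by (auto simp: support_def cube_def PiE_iff extensional_def fun_eq_iff)
qed

lemma card_cube_split:
  assumes "m \<le> n"
  shows "card {x \<in> cube n. \<phi> x} =
    (\<Sum>Z\<in>Pow {m..<n}. card {X \<in> Pow {..<m}. \<phi> (restrict (\<lambda>i. i \<in> X \<union> Z) {..<n})})"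
proof -
  let ?e = "\<lambda>(X, Z). restrict (\<lambda>i. i \<in> X \<union> Z) {..<n}"
  let ?S = "SIGMA Z:Pow {m..<n}. {X \<in> Pow {..<m}. \<phi> (restrict (\<lambda>i. i \<in> X \<union> Z) {..<n})}"
  have inj: "inj_on ?e (Pow {..<m} \<times> Pow {m..<n})" and im: "?e ` (Pow {..<m} \<times> Pow {m..<n}) = cube n"
    using bij_betw_cube[OF assms] by (auto simp: bij_betw_def)
  have "{x \<in> cube n. \<phi> x} = (\<lambda>(Z, X). ?e (X, Z)) ` ?S"
    unfolding im[symmetric] by (auto simp: image_iff)
  moreover have "inj_on (\<lambda>(Z, X). ?e (X, Z)) ?S"
    using inj unfolding inj_on_def by (simp add: split_beta) blast
  ultimately have "card {x \<in> cube n. \<phi> x} = card ?S"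
    by (simp add: card_image)
  also have "\<dots> = (\<Sum>Z\<in>Pow {m..<n}. card {X \<in> Pow {..<m}. \<phi> (restrict (\<lambda>i. i \<in> X \<union> Z) {..<n})})"
    by (subst card_SigmaI) auto
  finally show ?thesis .
qed

lemma support_restrict:
  assumes "m \<le> n" "X \<subseteq> {..<m}" "Z \<subseteq> {m..<n}"
  shows "support m (restrict (\<lambda>i. i \<in> X \<union> Z) {..<n}) = X"
  using assms by (auto simp: support_def)

text \<open>On each fibre over the coordinates from \<open>m\<close> on, a junta \<open>g\<close>
  becomes a function of the trace on \<open>J \<inter> {..<m}\<close>, possibly a different one for
  each fibre. The assumption applies to every fibre, and summing gives the claim.\<close>

lemma far_from_juntas_support:
  fixes \<epsilon> :: real
  assumes "m \<le> n"
    and far: "\<And>J g. J \<subseteq> {..<m} \<Longrightarrow> card J \<le> k \<Longrightarrow>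
      \<epsilon> * 2 ^ m \<le> card {X \<in> Pow {..<m}. f X \<noteq> g (X \<inter> J)}"
  shows "far_from_juntas n k \<epsilon> (\<lambda>x. f (support m x))"
  unfolding far_from_juntas_def
proof (intro allI impI)
  fix g assume "junta n k g"
  then obtain J where J: "J \<subseteq> {..<n}" "card J \<le> k"
    and dep: "\<forall>x\<in>cube n. \<forall>y\<in>cube n. (\<forall>i\<in>J. x i = y i) \<longrightarrow> g x = g y"
    unfolding junta_def by blast
  have J': "J \<inter> {..<m} \<subseteq> {..<m}" "card (J \<inter> {..<m}) \<le> k"
    using J card_mono[of J "J \<inter> {..<m}"] finite_subset[OF J(1)] by auto
  let ?e = "\<lambda>X Z. restrict (\<lambda>i. i \<in> X \<union> Z) {..<n}"
  have fibre: "\<epsilon> * 2 ^ m \<le> card {X \<in> Pow {..<m}. f (support m (?e X Z)) \<noteq> g (?e X Z)}"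
    if Z: "Z \<in> Pow {m..<n}" for Z
  proof -
    have "g (?e X Z) = g (?e (X \<inter> (J \<inter> {..<m})) Z)" if "X \<subseteq> {..<m}" for X
      by (rule dep[rule_format]) (use that J in \<open>auto simp: cube_def\<close>)
    then have "{X \<in> Pow {..<m}. f (support m (?e X Z)) \<noteq> g (?e X Z)}
        = {X \<in> Pow {..<m}. f X \<noteq> g (?e (X \<inter> (J \<inter> {..<m})) Z)}"
      using Z assms(1) support_restrict by auto
    then show ?thesis using far[OF J', of "\<lambda>Y. g (?e Y Z)"] by simp
  qed
  have "\<epsilon> * 2 ^ n = (\<Sum>Z\<in>Pow {m..<n}. \<epsilon> * 2 ^ m)"
    using assms(1) by (simp add: card_Pow flip: power_add)
  also have "\<dots> \<le> (\<Sum>Z\<in>Pow {m..<n}. real (card {X \<in> Pow {..<m}. f (support m (?e X Z)) \<noteq> g (?e X Z)}))"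
    by (rule sum_mono) (rule fibre)
  also have "\<dots> = card {x \<in> cube n. f (support m x) \<noteq> g x}"
    by (subst card_cube_split[OF assms(1)]) simp
  finally show "\<epsilon> \<le> distance n (\<lambda>x. f (support m x)) g"
    by (simp add: distance_def card_cube pos_le_divide_eq)
qed

lemma close_to_junta_support:
  fixes \<epsilon> :: real
  assumes "m \<le> n" "J \<subseteq> {..<m}" "card J \<le> k"
    and close: "card {X \<in> Pow {..<m}. f X \<noteq> g (X \<inter> J)} \<le> \<epsilon> * 2 ^ m"
  shows "close_to_junta n k \<epsilon> (\<lambda>x. f (support m x))"
  unfolding close_to_junta_def
proof (intro exI conjI)
  let ?g = "\<lambda>x. g (support m x \<inter> J)"
  show "junta n k ?g"
    unfolding junta_def
  proof (intro exI conjI ballI impI)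
    fix x y :: "nat \<Rightarrow> bool" assume "\<forall>i\<in>J. x i = y i"
    then have "support m x \<inter> J = support m y \<inter> J" by (auto simp: support_def)
    then show "?g x = ?g y" by simp
  qed (use assms in auto)
  let ?e = "\<lambda>X Z. restrict (\<lambda>i. i \<in> X \<union> Z) {..<n}"
  have "card {x \<in> cube n. f (support m x) \<noteq> ?g x} =
      (\<Sum>Z\<in>Pow {m..<n}. card {X \<in> Pow {..<m}. f (support m (?e X Z)) \<noteq> ?g (?e X Z)})"
    by (rule card_cube_split[OF assms(1)])
  also have "\<dots> = (\<Sum>Z\<in>Pow {m..<n}. card {X \<in> Pow {..<m}. f X \<noteq> g (X \<inter> J)})"
    using support_restrict[OF assms(1)]
    by (intro sum.cong refl arg_cong[where f = card] Collect_cong) auto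
  also have "\<dots> = 2 ^ (n - m) * card {X \<in> Pow {..<m}. f X \<noteq> g (X \<inter> J)}"
    by (simp add: card_Pow)
  finally have "real (card {x \<in> cube n. f (support m x) \<noteq> ?g x}) \<le> 2 ^ (n - m) * (\<epsilon> * 2 ^ m)"
    using close by simp
  also have "\<dots> = \<epsilon> * 2 ^ n" using assms(1) by (simp flip: power_add)
  finally show "distance n (\<lambda>x. f (support m x)) ?g \<le> \<epsilon>"
    by (simp add: distance_def card_cube pos_divide_le_eq)
qed

section \<open>Planted functions\<close>

lemma card_Pow_traces:
  assumes "finite U" "A \<subseteq> U" "R \<subseteq> U" "A \<inter> R = {}" "\<A> \<subseteq> Pow A" "\<B> \<subseteq> Pow R"
  shows "card {X \<in> Pow U. X \<inter> A \<in> \<A> \<and> X \<inter> R \<in> \<B>} = card \<A> * card \<B> * 2 ^ (card U - card A - card R)"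
proof -
  have "bij_betw (\<lambda>X. (X \<inter> A, X \<inter> R, X - A - R)) {X \<in> Pow U. X \<inter> A \<in> \<A> \<and> X \<inter> R \<in> \<B>}
      (\<A> \<times> \<B> \<times> Pow (U - A - R))"
  proof (rule bij_betwI[where g = "\<lambda>(B, C, D). B \<union> C \<union> D"])
    show "(\<lambda>X. (X \<inter> A, X \<inter> R, X - A - R)) \<in> {X \<in> Pow U. X \<inter> A \<in> \<A> \<and> X \<inter> R \<in> \<B>} \<rightarrow>
      \<A> \<times> \<B> \<times> Pow (U - A - R)" by auto
    have inv: "(B \<union> C \<union> D) \<inter> A = B \<and> (B \<union> C \<union> D) \<inter> R = C \<and> (B \<union> C \<union> D) - A - R = D"
      if "B \<in> \<A>" "C \<in> \<B>" "D \<subseteq> U - A - R" for B C D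
    proof -
      have "B \<subseteq> A" "C \<subseteq> R" using that assms by auto
      then show ?thesis using that(3) assms(4) by auto
    qed
    show "(\<lambda>(B, C, D). B \<union> C \<union> D) \<in> \<A> \<times> \<B> \<times> Pow (U - A - R) \<rightarrow> {X \<in> Pow U. X \<inter> A \<in> \<A> \<and> X \<inter> R \<in> \<B>}"
    proof
      fix p assume "p \<in> \<A> \<times> \<B> \<times> Pow (U - A - R)"
      then obtain B C D where p: "p = (B, C, D)" "B \<in> \<A>" "C \<in> \<B>" "D \<subseteq> U - A - R" by auto
      moreover have "B \<subseteq> U" "C \<subseteq> U" using p(2,3) assms(2,3,5,6) by blast+
      ultimately show "(\<lambda>(B, C, D). B \<union> C \<union> D) p \<in> {X \<in> Pow U. X \<inter> A \<in> \<A> \<and> X \<inter> R \<in> \<B>}"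
        using inv[of B C D] by auto
    qed
    fix p assume "p \<in> \<A> \<times> \<B> \<times> Pow (U - A - R)"
    then obtain B C D where "p = (B, C, D)" "B \<in> \<A>" "C \<in> \<B>" "D \<subseteq> U - A - R" by auto
    then show "((\<lambda>(B, C, D). B \<union> C \<union> D) p \<inter> A, (\<lambda>(B, C, D). B \<union> C \<union> D) p \<inter> R,
        (\<lambda>(B, C, D). B \<union> C \<union> D) p - A - R) = p"
      using inv[of B C D] by simp
  qed auto
  then have "card {X \<in> Pow U. X \<inter> A \<in> \<A> \<and> X \<inter> R \<in> \<B>} = card \<A> * (card \<B> * card (Pow (U - A - R)))"
    by (simp add: bij_betw_same_card card_cartesian_product)
  also have "U - A - R = U - (A \<union> R)" by auto
  also have "card (Pow (U - (A \<union> R))) = 2 ^ (card U - (card A + card R))"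
    using assms finite_subset[OF assms(2)] finite_subset[OF assms(3)]
    by (simp add: card_Pow card_Diff_subset card_Un_disjoint)
  finally show ?thesis by simp
qed

lemma card_Pow_trace:
  assumes "finite U" "A \<subseteq> U" "\<A> \<subseteq> Pow A"
  shows "card {X \<in> Pow U. X \<inter> A \<in> \<A>} = card \<A> * 2 ^ (card U - card A)"
  using card_Pow_traces[of U A "{}" \<A> "{{}}"] assms by simp

text \<open>
  A planted function is determined by its values at the points \<open>rep R \<K> X\<close>; of two antipodal points
  off the code, the one avoiding \<open>Min R\<close> is the representative and the other one is \<open>flipped\<close>.
\<close>

definition rep :: "nat set \<Rightarrow> nat set set \<Rightarrow> nat set \<Rightarrow> nat set" where
  "rep R \<K> X = (if X \<inter> R \<in> \<K> then (X - R) \<union> (SOME A. A \<in> \<K>)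
                else if Min R \<in> X then sym_diff X R else X)"

definition flipped :: "nat set \<Rightarrow> nat set set \<Rightarrow> nat set \<Rightarrow> bool" where
  "flipped R \<K> X \<longleftrightarrow> X \<inter> R \<notin> \<K> \<and> Min R \<in> X"

context
  fixes R :: "nat set" and \<K> :: "nat set set" and d :: nat
  assumes code: "antipodal_code R d \<K>" and nonempty: "\<K> \<noteq> {}"
begin

lemma some_codeword: "(SOME A. A \<in> \<K>) \<in> \<K>" "(SOME A. A \<in> \<K>) \<subseteq> R"
proof -
  show "(SOME A. A \<in> \<K>) \<in> \<K>" using nonempty by (simp add: some_in_eq)
  then show "(SOME A. A \<in> \<K>) \<subseteq> R" using code by (auto simp: antipodal_code_def)
qed

text \<open>The trace on \<open>R\<close> is replaced by its complement in \<open>R\<close>, so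
  closure of the code under complement applies.\<close>

lemma sym_diff_Int_mem_iff: "sym_diff X R \<inter> R \<in> \<K> \<longleftrightarrow> X \<inter> R \<in> \<K>"
proof -
  have "sym_diff X R \<inter> R = R - X \<inter> R" "R - (R - X \<inter> R) = X \<inter> R" by auto
  then show ?thesis using code by (metis antipodal_code_def)
qed

lemma rep_Int_mem_iff: "rep R \<K> X \<inter> R \<in> \<K> \<longleftrightarrow> X \<inter> R \<in> \<K>"
proof -
  have "((X - R) \<union> (SOME A. A \<in> \<K>)) \<inter> R = (SOME A. A \<in> \<K>)" using some_codeword(2) by auto
  then show ?thesis using some_codeword(1) sym_diff_Int_mem_iff by (auto simp: rep_def)
qed

lemma rep_subset: "X \<subseteq> U \<Longrightarrow> R \<subseteq> U \<Longrightarrow> rep R \<K> X \<subseteq> U"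
  using some_codeword(2) by (auto simp: rep_def)

text \<open>On the code, colliding points lie in one fibre and have distinct codewords as traces;
  off the code they are antipodal, so their difference is all of \<open>R\<close>.\<close>

lemma rep_collision:
  assumes "d \<le> card R" "rep R \<K> X = rep R \<K> Y" "X \<noteq> Y"
  shows "sym_diff X Y \<subseteq> R \<and> d \<le> card (sym_diff X Y)"
proof (cases "X \<inter> R \<in> \<K>")
  case True
  then have Y: "Y \<inter> R \<in> \<K>" using assms(2) rep_Int_mem_iff by metis
  have "(X - R) \<union> (SOME A. A \<in> \<K>) = (Y - R) \<union> (SOME A. A \<in> \<K>)"
    using assms(2) True Y by (simp add: rep_def)
  then have eq: "X - R = Y - R" using some_codeword(2) by blast
  then have "sym_diff X Y = sym_diff (X \<inter> R) (Y \<inter> R)" "X \<inter> R \<noteq> Y \<inter> R" using assms(3) by blast+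
  then show ?thesis using code True Y unfolding antipodal_code_def by auto
next
  case False
  then have Y: "Y \<inter> R \<notin> \<K>" using assms(2) rep_Int_mem_iff by metis
  have "X = sym_diff Y R \<or> sym_diff X R = Y \<or> sym_diff X R = sym_diff Y R"
    using assms(2,3) False Y by (simp add: rep_def split: if_splits)
  then have "sym_diff X Y = R" using assms(3) by blast
  then show ?thesis using assms(1) by auto
qed

text \<open>Disagreements occur only at active points off the code. There the map
  \<open>\<lambda>X. sym_diff X R\<close> pairs the points, negates the planted function and fixes
  the junta on \<open>U - R\<close>, so exactly one point of each pair is a disagreement, whatever
  \<open>F\<close> is.\<close>

lemma planted_disagreements:
  assumes "finite U" "R \<subseteq> U" "R \<noteq> {}" "A \<inter> R = {}"
  shows "2 * card {X \<in> Pow U. planted (\<lambda>X. X \<inter> A \<in> P) (rep R \<K>) (flipped R \<K>) F X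
              \<noteq> (X \<inter> (U - R) \<inter> A \<in> P \<and> F (X \<inter> (U - R) \<union> (SOME A. A \<in> \<K>)))}
       = card {X \<in> Pow U. X \<inter> A \<in> P \<and> X \<inter> R \<in> Pow R - \<K>}"
proof -
  let ?Y = "planted (\<lambda>X. X \<inter> A \<in> P) (rep R \<K>) (flipped R \<K>) F"
  let ?g = "\<lambda>X. X \<inter> (U - R) \<inter> A \<in> P \<and> F (X \<inter> (U - R) \<union> (SOME A. A \<in> \<K>))"
  let ?W = "{X \<in> Pow U. X \<inter> A \<in> P \<and> X \<inter> R \<in> Pow R - \<K>}"
  let ?D = "{X \<in> Pow U. ?Y X \<noteq> ?g X}"
  have act: "X \<inter> (U - R) \<inter> A = X \<inter> A" if "X \<subseteq> U" for X using that assms(4) by auto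
  have outside: "X \<inter> (U - R) = X - R" if "X \<subseteq> U" for X using that by auto
  have D_sub: "?D \<subseteq> ?W"
  proof
    fix X assume "X \<in> ?D"
    then show "X \<in> ?W"
      using act[of X] outside[of X] by (auto simp: planted_def rep_def flipped_def)
  qed
  have minR: "Min R \<in> R" using assms finite_subset by (intro Min_in) auto
  have flip_W: "sym_diff X R \<in> ?W" if "X \<in> ?W" for X
  proof -
    have "sym_diff X R \<inter> A = X \<inter> A" using assms(4) by auto
    then show ?thesis using that assms(2) sym_diff_Int_mem_iff[of X] by auto
  qed
  have flip: "?Y (sym_diff X R) \<noteq> ?Y X" "?g (sym_diff X R) = ?g X" if X: "X \<in> ?W" for X
  proof -
    have A: "sym_diff X R \<inter> A = X \<inter> A" using assms(4) by auto
    have R: "sym_diff X R - R = X - R" by auto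
    have RR: "sym_diff (sym_diff X R) R = X" by auto
    have m: "Min R \<in> sym_diff X R \<longleftrightarrow> Min R \<notin> X" using minR by auto
    have U: "X \<subseteq> U" "sym_diff X R \<subseteq> U" using X assms(2) by auto
    show "?g (sym_diff X R) = ?g X" using act[OF U(1)] act[OF U(2)] outside[OF U(1)] outside[OF U(2)] A R by simp
    have notK: "X \<inter> R \<notin> \<K>" "sym_diff X R \<inter> R \<notin> \<K>" using X sym_diff_Int_mem_iff[of X] by auto
    have "rep R \<K> (sym_diff X R) = rep R \<K> X" "flipped R \<K> (sym_diff X R) \<noteq> flipped R \<K> X"
      unfolding rep_def flipped_def using notK m RR by auto
    then show "?Y (sym_diff X R) \<noteq> ?Y X" using A X by (auto simp: planted_def)
  qed
  have "bij_betw (\<lambda>X. sym_diff X R) ?D (?W - ?D)"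
  proof (rule bij_betwI[where g = "\<lambda>X. sym_diff X R"])
    show "(\<lambda>X. sym_diff X R) \<in> ?D \<rightarrow> ?W - ?D"
    proof
      fix X assume X: "X \<in> ?D"
      then have W: "X \<in> ?W" using D_sub by blast
      show "sym_diff X R \<in> ?W - ?D" using flip_W[OF W] flip[OF W] X by blast
    qed
    show "(\<lambda>X. sym_diff X R) \<in> ?W - ?D \<rightarrow> ?D"
    proof
      fix X assume X: "X \<in> ?W - ?D"
      then have W: "X \<in> ?W" by blast
      then have "sym_diff X R \<in> Pow U" using flip_W[OF W] by blast
      moreover have "?Y X = ?g X" using X by blast
      ultimately show "sym_diff X R \<in> ?D" using flip[OF W] by blast
    qed
  qed auto
  then have "card ?D = card (?W - ?D)" by (rule bij_betw_same_card)
  moreover have "card (?W - ?D) = card ?W - card ?D"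
    using D_sub assms(1) by (intro card_Diff_subset) (auto intro: finite_subset)
  moreover have "card ?D \<le> card ?W"
    using D_sub assms(1) by (intro card_mono) auto
  ultimately show ?thesis by linarith
qed

end

section \<open>Averaging over the tester, and union bounds over juntas and collisions\<close>

text \<open>By linearity of expectation, a comparison of counts valid for each deterministic tree
  passes to the randomized tester.\<close>

lemma sum_prob_mono_of_card:
  fixes T :: "'t pmf"
  assumes "finite I" "finite I'"
    and "\<And>t. t \<in> set_pmf T \<Longrightarrow> \<alpha> * real (card {i \<in> I. E i t}) \<le> real (card {j \<in> I'. E' j t})"
  shows "\<alpha> * (\<Sum>i\<in>I. measure_pmf.prob T {t. E i t}) \<le> (\<Sum>j\<in>I'. measure_pmf.prob T {t. E' j t})"
proof -
  have sum_eq: "(\<Sum>i\<in>I. measure_pmf.prob T {t. E i t}) = measure_pmf.expectation T (\<lambda>t. real (card {i \<in> I. E i t}))"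
    and int: "integrable (measure_pmf T) (\<lambda>t. real (card {i \<in> I. E i t}))"
    if "finite I" for I :: "'i set" and E :: "'i \<Rightarrow> 't \<Rightarrow> bool"
  proof -
    have card: "real (card {i \<in> I. E i t}) = (\<Sum>i\<in>I. indicator {t. E i t} t)" for t
      using that by (simp add: indicator_def sum.If_cases Int_def)
    show "integrable (measure_pmf T) (\<lambda>t. real (card {i \<in> I. E i t}))"
      unfolding card by (intro Bochner_Integration.integrable_sum) (simp add: measure_pmf.emeasure_eq_measure)
    show "(\<Sum>i\<in>I. measure_pmf.prob T {t. E i t}) = measure_pmf.expectation T (\<lambda>t. real (card {i \<in> I. E i t}))"
      unfolding card by (subst Bochner_Integration.integral_sum) (simp_all add: measure_pmf.emeasure_eq_measure)
  qed
  have "\<alpha> * (\<Sum>i\<in>I. measure_pmf.prob T {t. E i t}) = measure_pmf.expectation T (\<lambda>t. \<alpha> * real (card {i \<in> I. E i t}))"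
    using sum_eq[OF assms(1)] by simp
  also have "\<dots> \<le> measure_pmf.expectation T (\<lambda>t. real (card {j \<in> I'. E' j t}))"
    using assms by (intro integral_mono_AE integrable_mult_right int) (auto simp: AE_measure_pmf_iff)
  also have "\<dots> = (\<Sum>j\<in>I'. measure_pmf.prob T {t. E' j t})"
    using sum_eq[OF assms(2)] by simp
  finally show ?thesis .
qed

text \<open>Union bound over at most \<open>2 ^ m\<close> sets \<open>J\<close> and
  \<open>2 ^ 2 ^ k\<close> tables on \<open>Pow J\<close>, with the Chernoff bound on the active
  points; \<open>large\<close> brings the total down to 1/4.\<close>

lemma masked_mostly_far:
  fixes \<tau> \<epsilon> :: real
  assumes "a \<le> m" "P \<subseteq> Pow {..<a}" "\<tau> \<ge> 0"
    and \<epsilon>: "\<epsilon> * 2 ^ m \<le> (1 / 2 - \<tau>) * (real (card P) * 2 ^ (m - a))"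
    and large: "4 * 2 ^ m * 2 ^ 2 ^ k \<le> exp (2 * \<tau>\<^sup>2 * (card P * 2 ^ (m - a)))"
  shows "4 * card {F \<in> Pow {..<m} \<rightarrow>\<^sub>E UNIV. \<exists>J g. J \<subseteq> {..<m} \<and> card J \<le> k \<and>
            card {X \<in> Pow {..<m}. masked (\<lambda>X. X \<inter> {..<a} \<in> P) F X \<noteq> g (X \<inter> J)} < \<epsilon> * 2 ^ m}
         \<le> card (Pow {..<m} \<rightarrow>\<^sub>E (UNIV :: bool set))"
proof -
  let ?S = "Pow {..<m}"
  let ?\<Omega> = "?S \<rightarrow>\<^sub>E (UNIV :: bool set)"
  let ?A = "{X \<in> ?S. X \<inter> {..<a} \<in> P}"
  let ?\<J> = "{J. J \<subseteq> {..<m} \<and> card J \<le> k}"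
  let ?few = "\<lambda>J h. {F \<in> ?\<Omega>. card {X \<in> ?A. F X \<noteq> h (X \<inter> J)} < (1 / 2 - \<tau>) * card ?A}"
  let ?bad = "{F \<in> ?\<Omega>. \<exists>J g. J \<subseteq> {..<m} \<and> card J \<le> k \<and>
            card {X \<in> ?S. masked (\<lambda>X. X \<inter> {..<a} \<in> P) F X \<noteq> g (X \<inter> J)} < \<epsilon> * 2 ^ m}"
  have fin: "finite ?\<Omega>" by (intro finite_PiE) auto
  have cA: "card ?A = card P * 2 ^ (m - a)"
    using card_Pow_trace[of "{..<m}" "{..<a}" P] assms(1,2) by auto
  have c\<Omega>: "card ?\<Omega> = 2 ^ card ?S" by (simp add: card_PiE)
  \<comment> \<open>Restricting \<open>g\<close> to \<open>Pow J\<close> leaves finitely many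
    candidates.\<close>
  have "?bad \<subseteq> (\<Union>J\<in>?\<J>. \<Union>h\<in>Pow J \<rightarrow>\<^sub>E UNIV. ?few J h)"
  proof
    fix F assume "F \<in> ?bad"
    then obtain J g where F: "F \<in> ?\<Omega>" and J: "J \<subseteq> {..<m}" "card J \<le> k"
      and few: "card {X \<in> ?S. masked (\<lambda>X. X \<inter> {..<a} \<in> P) F X \<noteq> g (X \<inter> J)} < \<epsilon> * 2 ^ m"
      by blast
    \<comment> \<open>Disagreements at inactive points are dropped; at active points the masked
      function is \<open>F\<close>.\<close>
    have "real (card {X \<in> ?A. F X \<noteq> restrict g (Pow J) (X \<inter> J)})
        \<le> card {X \<in> ?S. masked (\<lambda>X. X \<inter> {..<a} \<in> P) F X \<noteq> g (X \<inter> J)}"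
      by (intro of_nat_mono card_mono) (auto simp: masked_def)
    also have "\<dots> < \<epsilon> * 2 ^ m" by (rule few)
    also have "\<dots> \<le> (1 / 2 - \<tau>) * card ?A" using \<epsilon> unfolding cA by simp
    finally have "F \<in> ?few J (restrict g (Pow J))" using F by blast
    moreover have "restrict g (Pow J) \<in> Pow J \<rightarrow>\<^sub>E UNIV" by simp
    ultimately show "F \<in> (\<Union>J\<in>?\<J>. \<Union>h\<in>Pow J \<rightarrow>\<^sub>E UNIV. ?few J h)" using J by blast
  qed
  then have "card ?bad \<le> card (\<Union>J\<in>?\<J>. \<Union>h\<in>Pow J \<rightarrow>\<^sub>E UNIV. ?few J h)"
    by (rule card_mono[rotated]) (rule finite_subset[OF _ fin], blast)
  also have "\<dots> \<le> (\<Sum>J\<in>?\<J>. card (\<Union>h\<in>Pow J \<rightarrow>\<^sub>E UNIV. ?few J h))"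
    by (rule card_UN_le) simp
  also have "\<dots> \<le> (\<Sum>J\<in>?\<J>. \<Sum>h\<in>Pow J \<rightarrow>\<^sub>E UNIV. card (?few J h))"
    by (intro sum_mono card_UN_le finite_PiE) (auto intro: finite_subset)
  finally have "real (card ?bad) \<le> (\<Sum>J\<in>?\<J>. \<Sum>h\<in>Pow J \<rightarrow>\<^sub>E UNIV. real (card (?few J h)))"
    by (simp flip: of_nat_sum)
  also have "\<dots> \<le> (\<Sum>J\<in>?\<J>. \<Sum>h\<in>Pow J \<rightarrow>\<^sub>E (UNIV :: bool set). 2 ^ card ?S * exp (- 2 * \<tau>\<^sup>2 * card ?A))"
    using assms(3) by (intro sum_mono card_PiE_few_disagreements_le) auto
  also have "\<dots> \<le> (\<Sum>J\<in>?\<J>. 2 ^ 2 ^ k * (2 ^ card ?S * exp (- 2 * \<tau>\<^sup>2 * card ?A)))"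
  proof (intro sum_mono)
    fix J assume J: "J \<in> ?\<J>"
    then have fJ: "finite J" by (auto intro: finite_subset)
    have "card (Pow J \<rightarrow>\<^sub>E (UNIV :: bool set)) = 2 ^ 2 ^ card J"
      using fJ by (simp add: card_PiE card_Pow)
    also have "\<dots> \<le> 2 ^ 2 ^ k" using J by (intro power_increasing) auto
    finally have "real (card (Pow J \<rightarrow>\<^sub>E (UNIV :: bool set))) \<le> 2 ^ 2 ^ k"
      by (metis of_nat_le_iff of_nat_numeral of_nat_power)
    then show "(\<Sum>h\<in>Pow J \<rightarrow>\<^sub>E (UNIV :: bool set). 2 ^ card ?S * exp (- 2 * \<tau>\<^sup>2 * card ?A))
        \<le> 2 ^ 2 ^ k * (2 ^ card ?S * exp (- 2 * \<tau>\<^sup>2 * card ?A))"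
      by (simp add: mult_right_mono)
  qed
  also have "\<dots> \<le> 2 ^ m * (2 ^ 2 ^ k * (2 ^ card ?S * exp (- 2 * \<tau>\<^sup>2 * card ?A)))"
  proof -
    have "card ?\<J> \<le> card (Pow {..<m})" by (intro card_mono) auto
    then have "real (card ?\<J>) \<le> 2 ^ m"
      by (metis card_Pow card_lessThan finite_lessThan of_nat_le_iff of_nat_numeral of_nat_power)
    then show ?thesis by (simp add: mult_right_mono)
  qed
  finally have "4 * real (card ?bad) \<le> (4 * 2 ^ m * 2 ^ 2 ^ k) * (2 ^ card ?S * exp (- 2 * \<tau>\<^sup>2 * card ?A))"
    by simp
  also have "\<dots> \<le> exp (2 * \<tau>\<^sup>2 * card ?A) * (2 ^ card ?S * exp (- 2 * \<tau>\<^sup>2 * card ?A))"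
    using large cA by (intro mult_right_mono) auto
  also have "\<dots> = 2 ^ card ?S * (exp (2 * \<tau>\<^sup>2 * card ?A) * exp (- 2 * \<tau>\<^sup>2 * card ?A))" by simp
  also have "exp (2 * \<tau>\<^sup>2 * card ?A) * exp (- 2 * \<tau>\<^sup>2 * card ?A) = 1" by (simp flip: exp_add)
  finally have "real (4 * card ?bad) \<le> real (card ?\<Omega>)" using c\<Omega> by simp
  then show ?thesis by (simp only: of_nat_le_iff)
qed

text \<open>A collision forces \<open>R\<close> to contain the difference of two points of
  \<open>Q\<close>, of size at least \<open>d\<close>. The union bound runs over ordered pairs,
  hence the factor \<open>q * (q - 1)\<close>.\<close>

lemma card_hidden_sets_collision_le:
  assumes "finite H" "finite Q" "card Q \<le> q" "d \<le> r" "r \<le> card H"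
    and code: "\<And>R. R \<subseteq> H \<Longrightarrow> card R = r \<Longrightarrow> antipodal_code R d (\<K> R) \<and> \<K> R \<noteq> {}"
  shows "card {R. R \<subseteq> H \<and> card R = r \<and> \<not> inj_on (rep R (\<K> R)) Q} * card H ^ d
           \<le> q * (q - 1) * (r ^ d * (card H choose r))"
proof -
  let ?pairs = "{p \<in> Q \<times> Q. fst p \<noteq> snd p \<and> d \<le> card (sym_diff (fst p) (snd p)) \<and> sym_diff (fst p) (snd p) \<subseteq> H}"
  let ?hit = "\<lambda>p. {R. R \<subseteq> H \<and> card R = r \<and> sym_diff (fst p) (snd p) \<subseteq> R}"
  have finp: "finite ?pairs" using assms(2) by simp
  have fin: "finite {R. R \<subseteq> H \<and> card R = r \<and> \<phi> R}" for \<phi>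
    by (rule finite_subset[of _ "Pow H"]) (use assms(1) in auto)
  have "{R. R \<subseteq> H \<and> card R = r \<and> \<not> inj_on (rep R (\<K> R)) Q} \<subseteq> (\<Union>p\<in>?pairs. ?hit p)"
  proof
    fix R assume "R \<in> {R. R \<subseteq> H \<and> card R = r \<and> \<not> inj_on (rep R (\<K> R)) Q}"
    then obtain X Y where R: "R \<subseteq> H" "card R = r"
      and XY: "X \<in> Q" "Y \<in> Q" "X \<noteq> Y" "rep R (\<K> R) X = rep R (\<K> R) Y"
      by (auto simp: inj_on_def)
    have "sym_diff X Y \<subseteq> R \<and> d \<le> card (sym_diff X Y)"
      using rep_collision[of R d "\<K> R" X Y] code[OF R] R assms(4) XY by simp
    then have "(X, Y) \<in> ?pairs" "R \<in> ?hit (X, Y)" using R XY by auto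
    then show "R \<in> (\<Union>p\<in>?pairs. ?hit p)" by (rule UN_I)
  qed
  then have "card {R. R \<subseteq> H \<and> card R = r \<and> \<not> inj_on (rep R (\<K> R)) Q} \<le> card (\<Union>p\<in>?pairs. ?hit p)"
    using finp fin by (intro card_mono finite_UN_I) auto
  also have "\<dots> \<le> (\<Sum>p\<in>?pairs. card (?hit p))" by (rule card_UN_le[OF finp])
  finally have "card {R. R \<subseteq> H \<and> card R = r \<and> \<not> inj_on (rep R (\<K> R)) Q} * card H ^ d
      \<le> (\<Sum>p\<in>?pairs. card (?hit p)) * card H ^ d" by simp
  also have "\<dots> = (\<Sum>p\<in>?pairs. card (?hit p) * card H ^ d)" by (simp add: sum_distrib_right)
  also have "\<dots> \<le> (\<Sum>p\<in>?pairs. r ^ d * (card H choose r))"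
    using assms by (intro sum_mono card_supersets_of_size_le) auto
  also have "\<dots> = card ?pairs * (r ^ d * (card H choose r))" by simp
  also have "card ?pairs \<le> q * (q - 1)"
  proof -
    have "card ?pairs \<le> card (Q \<times> Q - (\<lambda>x. (x, x)) ` Q)"
      using assms(2) by (intro card_mono) auto
    also have "\<dots> = card Q * card Q - card Q"
      using assms(2) by (subst card_Diff_subset) (auto simp: card_cartesian_product card_image inj_on_def)
    also have "\<dots> = card Q * (card Q - 1)" by (simp add: diff_mult_distrib2)
    also have "\<dots> \<le> q * (q - 1)" using assms(3) by (intro mult_le_mono) auto
    finally show ?thesis .
  qed
  finally show ?thesis by simp
qed

section \<open>Query bounds\<close>

text \<open>If the bound fails, a random hidden set makes the points queried in a given run collide
  with probability at most 1/4. Masked functions are rejected with average probability at least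
  \<open>3/4 * 2/3 = 1/2\<close>, hence planted ones with at least \<open>3/4 * 1/2 = 3/8\<close>,
  which exceeds the 1/3 allowed. Here \<open>p / 2 ^ a\<close> is the density of active points and
  \<open>1 / 2 ^ t\<close> a lower bound for that of the code.\<close>

lemma tolerant_tester_query_bound:
  fixes \<epsilon>\<^sub>1 \<epsilon>\<^sub>2 \<tau> :: real and a b d k p q r t :: nat
  assumes d: "0 < d" "d \<le> r" and a: "a \<le> k" and n: "k + r \<le> n" and p: "p \<le> 2 ^ a"
    and volume: "(\<Sum>i<d. r choose i) \<le> 2 ^ t"
    and yes: "p / 2 ^ a * ((1 - 1 / 2 ^ t) / 2) \<le> \<epsilon>\<^sub>1"
    and no: "\<epsilon>\<^sub>2 \<le> p / 2 ^ a * (1 / 2 - \<tau>)" "\<tau> \<ge> 0"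
    and large: "4 * 2 ^ (k + r) * 2 ^ 2 ^ (k + b) \<le> exp (2 * \<tau>\<^sup>2 * (real p * 2 ^ (k + r - a)))"
    and tester: "tolerant_junta_tester n k (k + b) \<epsilon>\<^sub>1 \<epsilon>\<^sub>2 T"
    and queries: "\<And>t f. t \<in> set_pmf T \<Longrightarrow> num_queries t f \<le> q"
  shows "(k + r - a) ^ d \<le> 4 * (q * (q - 1) * r ^ d)"
proof (rule ccontr)
  assume contra: "\<not> ?thesis"
  \<comment> \<open>This size leaves exactly \<open>k\<close> coordinates outside a hidden set;
    \<open>h\<close> counts the non-public coordinates.\<close>
  define m where "m = k + r"
  define h where "h = k + r - a"
  let ?U = "{..<m}" and ?H = "{a..<m}"
  let ?\<Omega> = "Pow ?U \<rightarrow>\<^sub>E (UNIV :: bool set)"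
  let ?\<R> = "{R. R \<subseteq> ?H \<and> card R = r}"
  obtain P where P: "P \<subseteq> Pow {..<a}" "card P = p"
    using p obtain_subset_with_card_n[of p "Pow {..<a}"] by (auto simp: card_Pow)
  let ?act = "\<lambda>X. X \<inter> {..<a} \<in> P"
  have "\<exists>\<K>. antipodal_code R d \<K> \<and> 2 ^ r \<le> card \<K> * 2 ^ t" if R: "R \<in> ?\<R>" for R
  proof -
    have "finite R" using R finite_subset by auto
    then obtain \<K> where \<K>: "antipodal_code R d \<K>" "2 ^ r \<le> card \<K> * (\<Sum>i<d. r choose i)"
      using antipodal_gilbert_varshamov[of R d] R d by auto
    then have "2 ^ r \<le> card \<K> * 2 ^ t" using volume by (meson le_trans mult_le_mono2)
    then show ?thesis using \<K> by blast
  qed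
  then have "\<forall>R\<in>?\<R>. \<exists>\<K>. antipodal_code R d \<K> \<and> 2 ^ r \<le> card \<K> * 2 ^ t" by (rule ballI)
  from bchoice[OF this] obtain \<K> where code: "\<And>R. R \<in> ?\<R> \<Longrightarrow> antipodal_code R d (\<K> R)"
    and size: "\<And>R. R \<in> ?\<R> \<Longrightarrow> 2 ^ r \<le> card (\<K> R) * 2 ^ t" by blast
  have nonempty: "\<K> R \<noteq> {}" if "R \<in> ?\<R>" for R
    using size[OF that] by (auto simp: not_le)
  let ?Y = "\<lambda>R F. planted ?act (rep R (\<K> R)) (flipped R (\<K> R)) F"
  let ?N = "\<lambda>F. masked ?act F"
  have fin\<Omega>: "finite ?\<Omega>" by (intro finite_PiE) auto
  have fin\<R>: "finite ?\<R>" by (rule finite_subset[of _ "Pow ?H"]) auto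
  have cardH: "card ?H = h" by (simp add: m_def h_def)
  have card\<R>: "card ?\<R> = h choose r" using n_subsets[of ?H r] cardH by simp
  have rh: "r \<le> h" using a by (simp add: h_def)
  have card\<R>_pos: "card ?\<R> > 0" using rh card\<R> by simp
  have card\<Omega>_pos: "card ?\<Omega> > 0" by (simp add: card_PiE)
  have am: "a \<le> m" using a by (simp add: m_def)

  have reject_yes: "measure_pmf.prob T {t. \<not> accepts t (\<lambda>x. ?Y R F (support m x))} \<le> 1 / 3"
    if R: "R \<in> ?\<R>" for R F
  proof -
    have RU: "R \<subseteq> ?U" "R \<noteq> {}" "{..<a} \<inter> R = {}" "card R = r" using R d by auto
    have fR: "finite R" using RU(1) finite_subset by blast
    have KR: "\<K> R \<subseteq> Pow R" using code[OF R] by (simp add: antipodal_code_def)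
    let ?g = "\<lambda>X. ?act X \<and> F (X \<union> (SOME A. A \<in> \<K> R))"
    let ?D = "{X \<in> Pow ?U. ?Y R F X \<noteq> ?g (X \<inter> (?U - R))}"
    have "2 * card ?D = card {X \<in> Pow ?U. X \<inter> {..<a} \<in> P \<and> X \<inter> R \<in> Pow R - \<K> R}"
      using planted_disagreements[OF code[OF R] nonempty[OF R], of ?U "{..<a}" P F] RU by simp
    also have "\<dots> = p * card (Pow R - \<K> R) * 2 ^ (m - a - r)"
      using card_Pow_traces[of ?U "{..<a}" R P "Pow R - \<K> R"] RU P am by auto
    also have "card (Pow R - \<K> R) = 2 ^ r - card (\<K> R)"
      using KR fR RU(4) by (simp add: card_Diff_subset finite_subset card_Pow)
    finally have two: "2 * card ?D = p * (2 ^ r - card (\<K> R)) * 2 ^ (m - a - r)" .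
    have "card (\<K> R) \<le> 2 ^ r" using card_mono[OF _ KR] fR RU(4) by (simp add: card_Pow)
    then have "real (2 ^ r - card (\<K> R)) = 2 ^ r - real (card (\<K> R))" by (simp add: of_nat_diff)
    also have "\<dots> \<le> 2 ^ r * (1 - 1 / 2 ^ t)"
    proof -
      have "real (2 ^ r) \<le> real (card (\<K> R) * 2 ^ t)" using size[OF R] by (simp only: of_nat_le_iff)
      then have "2 ^ r / 2 ^ t \<le> real (card (\<K> R))" by (simp add: pos_divide_le_eq)
      then show ?thesis by (simp add: right_diff_distrib)
    qed
    finally have le: "real (2 ^ r - card (\<K> R)) \<le> 2 ^ r * (1 - 1 / 2 ^ t)" .
    have "2 * real (card ?D) = real p * real (2 ^ r - card (\<K> R)) * 2 ^ (m - a - r)"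
      using arg_cong[OF two, of real] by simp
    also have "\<dots> \<le> real p * (2 ^ r * (1 - 1 / 2 ^ t)) * 2 ^ (m - a - r)"
      using le by (intro mult_right_mono mult_left_mono) auto
    also have "\<dots> = real p * (1 - 1 / 2 ^ t) * 2 ^ (m - a)"
    proof -
      have "(2::real) ^ r * 2 ^ (m - a - r) = 2 ^ (m - a)"
        using a by (simp add: m_def flip: power_add)
      then show ?thesis by (simp add: mult_ac)
    qed
    also have "(2::real) ^ (m - a) = 2 ^ m / 2 ^ a" using am by (simp add: power_diff)
    also have "real p * (1 - 1 / 2 ^ t) * (2 ^ m / 2 ^ a) = 2 * (p / 2 ^ a * ((1 - 1 / 2 ^ t) / 2)) * 2 ^ m"
      by simp
    also have "\<dots> \<le> 2 * \<epsilon>\<^sub>1 * 2 ^ m" using yes by (intro mult_right_mono mult_left_mono) auto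
    finally have "card ?D \<le> \<epsilon>\<^sub>1 * 2 ^ m" by simp
    moreover have "card (?U - R) \<le> k" using RU fR by (simp add: card_Diff_subset m_def)
    ultimately have "close_to_junta n k \<epsilon>\<^sub>1 (\<lambda>x. ?Y R F (support m x))"
      using close_to_junta_support[of m n "?U - R" k "?Y R F" ?g \<epsilon>\<^sub>1] n by (simp add: m_def)
    then have "measure_pmf.prob T {t. accepts t (\<lambda>x. ?Y R F (support m x))} \<ge> 2 / 3"
      using tester by (simp add: tolerant_junta_tester_def)
    moreover have "{t. \<not> accepts t (\<lambda>x. ?Y R F (support m x))}
        = space (measure_pmf T) - {t. accepts t (\<lambda>x. ?Y R F (support m x))}" by auto
    ultimately show ?thesis
      using measure_pmf.prob_compl[of "{t. accepts t (\<lambda>x. ?Y R F (support m x))}" T] by simp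
  qed

  define bad where "bad = {F \<in> ?\<Omega>. \<exists>J g. J \<subseteq> ?U \<and> card J \<le> k + b \<and>
            card {X \<in> Pow ?U. ?N F X \<noteq> g (X \<inter> J)} < \<epsilon>\<^sub>2 * 2 ^ m}"
  have bad_sub: "bad \<subseteq> ?\<Omega>" unfolding bad_def by (rule Collect_restrict)
  have "\<epsilon>\<^sub>2 * 2 ^ m \<le> (p / 2 ^ a * (1 / 2 - \<tau>)) * 2 ^ m" using no(1) by (intro mult_right_mono) auto
  also have "\<dots> = (1 / 2 - \<tau>) * (real p * 2 ^ (m - a))" using am by (simp add: power_diff)
  finally have bad: "4 * card bad \<le> card ?\<Omega>"
    unfolding bad_def using masked_mostly_far[OF am P(1) no(2)] large P(2) by (simp add: m_def)
  have reject_no: "measure_pmf.prob T {t. \<not> accepts t (\<lambda>x. ?N F (support m x))} \<ge> 2 / 3"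
    if F: "F \<in> ?\<Omega> - bad" for F
  proof -
    have "\<epsilon>\<^sub>2 * 2 ^ m \<le> card {X \<in> Pow ?U. ?N F X \<noteq> g (X \<inter> J)}"
      if "J \<subseteq> ?U" "card J \<le> k + b" for J g
    proof (rule ccontr)
      assume "\<not> ?thesis"
      then have "card {X \<in> Pow ?U. ?N F X \<noteq> g (X \<inter> J)} < \<epsilon>\<^sub>2 * 2 ^ m" by (rule not_le_imp_less)
      moreover have "F \<in> ?\<Omega>" using F by (rule DiffD1)
      ultimately have "F \<in> bad" unfolding bad_def using that by (intro CollectI conjI exI)
      then show False using F by (elim DiffE notE)
    qed
    then have "far_from_juntas n (k + b) \<epsilon>\<^sub>2 (\<lambda>x. ?N F (support m x))"
      using n by (intro far_from_juntas_support) (auto simp: m_def)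
    then show ?thesis using tester by (simp add: tolerant_junta_tester_def)
  qed

  have per_tree: "3 / 4 * card ?\<R> * real (card {F \<in> ?\<Omega>. \<not> accepts t (\<lambda>x. ?N F (support m x))})
      \<le> real (card {z \<in> ?\<R> \<times> ?\<Omega>. \<not> accepts t (\<lambda>x. ?Y (fst z) (snd z) (support m x))})"
    if t: "t \<in> set_pmf T" for t
  proof -
    \<comment> \<open>Queried points are replaced by their supports; points with equal support
      merge, so a path still has at most \<open>q\<close> elements.\<close>
    define t' where "t' = map_decision_tree (support m) t"
    have acc: "accepts t (\<lambda>x. f (support m x)) = accepts t' f" for f by (simp add: t'_def)
    have qd: "queried t' \<subseteq> Pow ?U" by (auto simp: t'_def decision_tree.set_map support_def)
    have few: "card (query_path t' f) \<le> q" for f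
      using card_query_path_le[of t' f] queries[OF t, of "\<lambda>x. f (support m x)"] by (simp add: t'_def)
    have inj: "3 * card ?\<R> \<le> 4 * card {R \<in> ?\<R>. inj_on (rep R (\<K> R)) (query_path t' f)}" for f
    proof -
      let ?B = "{R. R \<subseteq> ?H \<and> card R = r \<and> \<not> inj_on (rep R (\<K> R)) (query_path t' f)}"
      have "card ?B * h ^ d \<le> q * (q - 1) * (r ^ d * card ?\<R>)"
        using card_hidden_sets_collision_le[of ?H "query_path t' f" q d r \<K>] few d rh cardH card\<R> code nonempty
        by auto
      then have "4 * card ?B * h ^ d \<le> 4 * (q * (q - 1) * r ^ d) * card ?\<R>" by simp
      also have "\<dots> \<le> h ^ d * card ?\<R>" using contra by (intro mult_le_mono1) (simp add: h_def)
      finally have "h ^ d * (4 * card ?B) \<le> h ^ d * card ?\<R>" by (simp add: mult.commute)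
      then have "4 * card ?B \<le> card ?\<R>" using rh d by simp
      moreover have "card ?\<R> = card (?B \<union> {R \<in> ?\<R>. inj_on (rep R (\<K> R)) (query_path t' f)})"
        by (rule arg_cong[where f = card]) auto
      moreover have "\<dots> \<le> card ?B + card {R \<in> ?\<R>. inj_on (rep R (\<K> R)) (query_path t' f)}"
        by (rule card_Un_le)
      ultimately show ?thesis by linarith
    qed
    let ?rej = "{F \<in> ?\<Omega>. \<not> accepts t' (?N F)}"
    have finrej: "finite ?rej" using fin\<Omega> by simp
    have "3 * card ?\<R> * card ?rej = (\<Sum>F\<in>?rej. 3 * card ?\<R>)" by simp
    also have "\<dots> \<le> (\<Sum>F\<in>?rej. 4 * card {R \<in> ?\<R>. inj_on (rep R (\<K> R)) (query_path t' (?N F))})"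
      by (rule sum_mono) (rule inj)
    also have "\<dots> = 4 * (\<Sum>F\<in>?rej. card {R \<in> ?\<R>. inj_on (rep R (\<K> R)) (query_path t' (?N F))})"
      by (simp add: sum_distrib_left)
    \<comment> \<open>Double counting of pairs \<open>(F, R)\<close> without collision; masked and
      planted functions are then compared for each fixed \<open>R\<close>.\<close>
    also have "(\<Sum>F\<in>?rej. card {R \<in> ?\<R>. inj_on (rep R (\<K> R)) (query_path t' (?N F))})
        = (\<Sum>R\<in>?\<R>. card {F \<in> ?rej. inj_on (rep R (\<K> R)) (query_path t' (?N F))})"
      using sum_multicount_gen[OF finrej fin\<R>, of "\<lambda>F R. inj_on (rep R (\<K> R)) (query_path t' (?N F))"
          "\<lambda>R. card {F \<in> ?rej. inj_on (rep R (\<K> R)) (query_path t' (?N F))}"] by blast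
    also have "\<dots> \<le> (\<Sum>R\<in>?\<R>. card {F \<in> ?\<Omega>. \<not> accepts t' (?Y R F)})"
    proof (rule sum_mono)
      fix R assume R: "R \<in> ?\<R>"
      then have "R \<subseteq> ?U" by auto
      then have "rep R (\<K> R) ` Pow ?U \<subseteq> Pow ?U"
        using rep_subset[OF code[OF R] nonempty[OF R]] by blast
      then have "card {F \<in> ?\<Omega>. \<not> accepts t' (?N F) \<and> inj_on (rep R (\<K> R)) (query_path t' (?N F))}
          \<le> card {F \<in> ?\<Omega>. \<not> accepts t' (?Y R F)}"
        using qd by (intro card_rejecting_masked_le_planted) auto
      moreover have "{F \<in> ?rej. inj_on (rep R (\<K> R)) (query_path t' (?N F))}
          = {F \<in> ?\<Omega>. \<not> accepts t' (?N F) \<and> inj_on (rep R (\<K> R)) (query_path t' (?N F))}" by blast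
      ultimately show "card {F \<in> ?rej. inj_on (rep R (\<K> R)) (query_path t' (?N F))}
          \<le> card {F \<in> ?\<Omega>. \<not> accepts t' (?Y R F)}" by (simp only:)
    qed
    also have "\<dots> = card (SIGMA R:?\<R>. {F \<in> ?\<Omega>. \<not> accepts t' (?Y R F)})"
      using fin\<R> fin\<Omega> by (subst card_SigmaI) auto
    also have "(SIGMA R:?\<R>. {F \<in> ?\<Omega>. \<not> accepts t' (?Y R F)})
        = {z \<in> ?\<R> \<times> ?\<Omega>. \<not> accepts t' (?Y (fst z) (snd z))}" by auto
    finally have "3 * card ?\<R> * card ?rej \<le> 4 * card {z \<in> ?\<R> \<times> ?\<Omega>. \<not> accepts t' (?Y (fst z) (snd z))}" by simp
    then have "real (3 * card ?\<R> * card ?rej) \<le> real (4 * card {z \<in> ?\<R> \<times> ?\<Omega>. \<not> accepts t' (?Y (fst z) (snd z))})"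
      by (simp only: of_nat_le_iff)
    then show ?thesis unfolding acc by simp
  qed

  have "3 / 4 * card ?\<R> * (\<Sum>F\<in>?\<Omega>. measure_pmf.prob T {t. \<not> accepts t (\<lambda>x. ?N F (support m x))})
      \<le> (\<Sum>p\<in>?\<R> \<times> ?\<Omega>. measure_pmf.prob T {t. \<not> accepts t (\<lambda>x. ?Y (fst p) (snd p) (support m x))})"
    using fin\<Omega> fin\<R> by (intro sum_prob_mono_of_card per_tree finite_cartesian_product)
  also have "\<dots> \<le> (\<Sum>p\<in>?\<R> \<times> ?\<Omega>. 1 / 3)"
    by (intro sum_mono reject_yes) auto
  also have "\<dots> = card ?\<R> * card ?\<Omega> / 3" by (simp add: card_cartesian_product)
  finally have "3 / 4 * (\<Sum>F\<in>?\<Omega>. measure_pmf.prob T {t. \<not> accepts t (\<lambda>x. ?N F (support m x))}) \<le> card ?\<Omega> / 3"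
    using card\<R>_pos by (simp add: field_simps)
  moreover have "card ?\<Omega> / 2 \<le> (\<Sum>F\<in>?\<Omega>. measure_pmf.prob T {t. \<not> accepts t (\<lambda>x. ?N F (support m x))})"
  proof -
    have "real (card (?\<Omega> - bad)) = card ?\<Omega> - card bad"
      using bad_sub fin\<Omega> by (simp add: card_Diff_subset finite_subset card_mono of_nat_diff)
    then have "card ?\<Omega> / 2 \<le> (\<Sum>F\<in>?\<Omega> - bad. 2 / 3)"
      using bad by simp
    also have "\<dots> \<le> (\<Sum>F\<in>?\<Omega> - bad. measure_pmf.prob T {t. \<not> accepts t (\<lambda>x. ?N F (support m x))})"
      by (intro sum_mono reject_no)
    also have "\<dots> \<le> (\<Sum>F\<in>?\<Omega>. measure_pmf.prob T {t. \<not> accepts t (\<lambda>x. ?N F (support m x))})"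
      using fin\<Omega> by (intro sum_mono2) auto
    finally show ?thesis .
  qed
  ultimately show False using card\<Omega>_pos by linarith
qed

section \<open>Choice of parameters for large and small gaps\<close>

lemma two_powers_le_exp:
  assumes "2 + m + 2 ^ j \<le> N" "real N \<le> x"
  shows "4 * 2 ^ m * 2 ^ 2 ^ j \<le> exp x"
proof -
  have "(4::real) * 2 ^ m * 2 ^ 2 ^ j = 2 ^ (2 + m + 2 ^ j)" by (simp add: power_add)
  also have "\<dots> \<le> 2 ^ N" using assms(1) by (intro power_increasing) auto
  also have "\<dots> \<le> exp 1 ^ N" using exp_ge_add_one_self[of 1] by (intro power_mono) auto
  also have "\<dots> = exp (real N)" by (simp flip: exp_of_nat_mult)
  also have "\<dots> \<le> exp x" using assms(2) by simp
  finally show ?thesis .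
qed

text \<open>Parameters \<open>a = 0\<close>, \<open>p = 1\<close>, \<open>d = 1\<close>,
  \<open>t = 0\<close>, \<open>r = b + 60\<close>: all points are active and the code is
  \<open>Pow R\<close>, so "yes" functions are exact juntas. The choice
  \<open>\<tau> = 1 / 128\<close> works since \<open>1/2 - 1/128 > 49/100\<close>. The bound has
  order \<open>sqrt (k / b)\<close> and is strong enough for bounded \<open>b\<close>.\<close>

lemma query_bound_large_gap:
  fixes \<epsilon>\<^sub>1 \<epsilon>\<^sub>2 :: real
  assumes "0 \<le> \<epsilon>\<^sub>1" "\<epsilon>\<^sub>2 \<le> 49 / 100" "k + (b + 60) \<le> n"
    and "tolerant_junta_tester n k (k + b) \<epsilon>\<^sub>1 \<epsilon>\<^sub>2 T"
    and "\<And>t f. t \<in> set_pmf T \<Longrightarrow> num_queries t f \<le> q"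
  shows "k + b + 60 \<le> 4 * (q * (q - 1) * (b + 60))"
proof -
  have "k + b < 2 ^ (k + b)" by (rule less_exp)
  \<comment> \<open>The exponent comes from
    \<open>2 * (1 / 128)\<^sup>2 * 2 ^ 60 = 2 ^ 47\<close>.\<close>
  moreover have "(2::nat) ^ (k + b + 47) = 140737488355328 * 2 ^ (k + b)"
    by (simp add: power_add)
  ultimately have "2 + (k + (b + 60)) + 2 ^ (k + b) \<le> 2 ^ (k + b + 47)"
    by linarith
  then have "4 * 2 ^ (k + (b + 60)) * 2 ^ 2 ^ (k + b)
      \<le> exp (2 * (1 / 128)\<^sup>2 * (real 1 * 2 ^ (k + (b + 60) - 0)))"
    by (rule two_powers_le_exp) (simp add: power_add power2_eq_square)
  from tolerant_tester_query_bound[OF _ _ _ assms(3) _ _ _ _ _ this assms(4,5), of 1 0] assms(1,2)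
  show ?thesis by (simp add: field_simps)
qed

text \<open>Parameters \<open>a = b + 7\<close>, \<open>r = 4 * b\<close>,
  \<open>d = b div 15\<close>, \<open>t = b\<close>. Relative to the active points, "yes" functions
  have distance at most \<open>(1 - w) / 2\<close> from a junta and most "no" functions at least
  \<open>1 / 2 - \<tau>\<close>. As \<open>\<tau>\<close> is far below \<open>w\<close>, some
  density of active points fits both thresholds.\<close>

lemma query_bound_small_gap:
  fixes \<epsilon>\<^sub>1 \<epsilon>\<^sub>2 :: real
  assumes \<epsilon>: "1 / 100 \<le> \<epsilon>\<^sub>1" "\<epsilon>\<^sub>1 \<le> \<epsilon>\<^sub>2" "\<epsilon>\<^sub>2 \<le> 49 / 100" "\<epsilon>\<^sub>2 - \<epsilon>\<^sub>1 \<le> 1 / 2 ^ (b + 10)"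
    and b: "30 \<le> b" "20 * b \<le> k" and n: "k + 4 * b \<le> n"
    and tester: "tolerant_junta_tester n k (k + b) \<epsilon>\<^sub>1 \<epsilon>\<^sub>2 T"
    and queries: "\<And>t f. t \<in> set_pmf T \<Longrightarrow> num_queries t f \<le> q"
  shows "k ^ (b div 15) \<le> 4 * (q * (q - 1) * (4 * b) ^ (b div 15))"
proof -
  define w :: real where "w = 1 / 2 ^ b"
  \<comment> \<open>This equals the largest admissible gap \<open>1 / 2 ^ (b + 10)\<close>.\<close>
  define \<tau> where "\<tau> = w / 1024"
  define L where "L = 2 * \<epsilon>\<^sub>2 / (1 - 2 * \<tau>)"
  \<comment> \<open>The density \<open>p / 2 ^ (b + 7)\<close> has to lie between \<open>2 * \<epsilon>\<^sub>2 / (1 - 2 * \<tau>)\<close> and \<open>2 * \<epsilon>\<^sub>1 / (1 - w)\<close>.\<close>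
  define p where "p = nat \<lceil>2 ^ (b + 7) * L\<rceil>"
  have w: "0 < w" "w \<le> 1" by (auto simp: w_def)
  have \<tau>: "0 < \<tau>" "\<tau> \<le> 1 / 1024" using w by (auto simp: \<tau>_def)
  have L_pos: "0 < L" using \<epsilon> \<tau> by (auto simp: L_def)
  have L_le1: "L \<le> 1" using \<epsilon> \<tau> by (simp add: L_def pos_divide_le_eq)
  have L_ge: "1 / 50 \<le> L"
  proof -
    have "1 / 50 * (1 - 2 * \<tau>) \<le> 2 * \<epsilon>\<^sub>2" using \<epsilon> \<tau> by (simp add: algebra_simps)
    then show ?thesis using \<tau> by (simp add: L_def pos_le_divide_eq)
  qed
  have L_le: "L \<le> 2 * \<epsilon>\<^sub>2 + 4 * \<tau>"
  proof -
    have "\<epsilon>\<^sub>2 * \<tau> \<le> 1 / 2 * \<tau>" using \<epsilon> \<tau> by (intro mult_right_mono) auto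
    moreover have "\<tau> * \<tau> \<le> 1 / 1024 * \<tau>" using \<tau> by (intro mult_right_mono) auto
    moreover have "(2 * \<epsilon>\<^sub>2 + 4 * \<tau>) * (1 - 2 * \<tau>) = 2 * \<epsilon>\<^sub>2 + 4 * \<tau> - 4 * (\<epsilon>\<^sub>2 * \<tau>) - 8 * (\<tau> * \<tau>)"
      by (simp add: algebra_simps)
    ultimately have "2 * \<epsilon>\<^sub>2 \<le> (2 * \<epsilon>\<^sub>2 + 4 * \<tau>) * (1 - 2 * \<tau>)" using \<tau> by linarith
    then show ?thesis using \<tau> by (simp add: L_def pos_divide_le_eq)
  qed
  have p_ge: "2 ^ (b + 7) * L \<le> p" using L_pos by (simp add: p_def)
  have p_le: "p \<le> 2 ^ (b + 7) * L + 1" using L_pos by (simp add: p_def)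
  have p_le': "p \<le> 2 ^ (b + 7)"
  proof -
    have "2 ^ (b + 7) * L \<le> of_int (2 ^ (b + 7))" using L_le1 by simp
    then have "\<lceil>2 ^ (b + 7) * L\<rceil> \<le> 2 ^ (b + 7)" by (simp only: ceiling_le_iff)
    then show ?thesis by (simp add: p_def nat_le_iff)
  qed
  have density_ge: "L \<le> p / 2 ^ (b + 7)" using p_ge by (simp add: pos_le_divide_eq mult.commute)
  have density_le: "p / 2 ^ (b + 7) \<le> L + w / 128"
    using p_le by (simp add: pos_divide_le_eq w_def power_add field_simps)
  have gap: "\<epsilon>\<^sub>2 - \<epsilon>\<^sub>1 \<le> \<tau>" using \<epsilon>(4) by (simp add: \<tau>_def w_def power_add)
  \<comment> \<open>Here \<open>14 = 8 + 4 + 2\<close>: rounding \<open>p\<close> costs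
    \<open>w / 128 = 8 * \<tau>\<close>, \<open>L_le\<close> costs \<open>4 * \<tau>\<close>, and
    twice the gap costs \<open>2 * \<tau>\<close>.\<close>
  have "p / 2 ^ (b + 7) \<le> 2 * \<epsilon>\<^sub>1 + 14 * \<tau>"
    using density_le L_le gap by (simp add: \<tau>_def)
  then have "p / 2 ^ (b + 7) * ((1 - w) / 2) \<le> (2 * \<epsilon>\<^sub>1 + 14 * \<tau>) * ((1 - w) / 2)"
    using w by (intro mult_right_mono) auto
  also have "\<dots> \<le> \<epsilon>\<^sub>1"
  proof -
    \<comment> \<open>The gain from the code, at least \<open>w / 100\<close>, beats the loss
      \<open>7 * \<tau> = 7 * w / 1024\<close>.\<close>
    have "1 / 100 * w \<le> \<epsilon>\<^sub>1 * w" using \<epsilon> w by (intro mult_right_mono) auto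
    moreover have "0 \<le> \<tau> * w" using \<tau> w by simp
    moreover have "(2 * \<epsilon>\<^sub>1 + 14 * \<tau>) * ((1 - w) / 2) = \<epsilon>\<^sub>1 - \<epsilon>\<^sub>1 * w + 7 * \<tau> - 7 * (\<tau> * w)"
      by (simp add: field_simps)
    moreover have "\<tau> = w / 1024" by (rule \<tau>_def)
    ultimately show ?thesis using w by linarith
  qed
  finally have yes: "p / 2 ^ (b + 7) * ((1 - 1 / 2 ^ b) / 2) \<le> \<epsilon>\<^sub>1" by (simp add: w_def)
  have "\<epsilon>\<^sub>2 = L * (1 / 2 - \<tau>)" using \<tau> by (simp add: L_def field_simps)
  also have "\<dots> \<le> p / 2 ^ (b + 7) * (1 / 2 - \<tau>)" using density_ge \<tau> by (intro mult_right_mono) auto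
  finally have no: "\<epsilon>\<^sub>2 \<le> p / 2 ^ (b + 7) * (1 / 2 - \<tau>)" .
  have lin: "4 * j + 2 \<le> 2 ^ j" if "5 \<le> j" for j :: nat
    using that by (induction j rule: dec_induct) auto
  have large: "4 * 2 ^ (k + 4 * b) * 2 ^ 2 ^ (k + b)
      \<le> exp (2 * \<tau>\<^sup>2 * (real p * 2 ^ (k + 4 * b - (b + 7))))"
  proof (rule two_powers_le_exp)
    show "2 + (k + 4 * b) + 2 ^ (k + b) \<le> (2::nat) ^ (k + b + 1)"
      using lin[of "k + b"] b by simp
    \<comment> \<open>The target exponent is \<open>k + 2 * b - 25\<close>, where
      \<open>25 = 20 + 6 - 1\<close> collects \<open>\<tau>\<^sup>2\<close>, the density bound 1/64
      and the factor 2; the slack \<open>b - 26\<close> is not truncated because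
      \<open>30 \<le> b\<close>.\<close>
    have "real (2 ^ (k + b + 1)) \<le> 2 ^ (k + b + 1 + (b - 26))"
      by (simp only: of_nat_power of_nat_numeral) (rule power_increasing, auto)
    also have "k + b + 1 + (b - 26) = k + 2 * b - 25" using b by simp
    also have "(2::real) ^ (k + 2 * b - 25) = 2 ^ (k + 4 * b) / 2 ^ (2 * b + 25)"
      using b by (simp add: power_diff[symmetric])
    also have "\<dots> = 2 * (1 / 2 ^ (2 * b + 20)) * (1 / 64 * 2 ^ (k + 4 * b))"
      by (simp add: power_add)
    also have "1 / 2 ^ (2 * b + 20) = \<tau>\<^sup>2"
    proof -
      have "\<tau> = 1 / 2 ^ (b + 10)" by (simp add: \<tau>_def w_def power_add)
      then show ?thesis by (simp add: power_divide algebra_simps flip: power_mult)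
    qed
    also have "2 * \<tau>\<^sup>2 * (1 / 64 * 2 ^ (k + 4 * b)) \<le> 2 * \<tau>\<^sup>2 * (p / 2 ^ (b + 7) * 2 ^ (k + 4 * b))"
    proof -
      have "1 / 64 \<le> p / 2 ^ (b + 7)" using L_ge density_ge by linarith
      then show ?thesis by (intro mult_left_mono mult_right_mono) simp_all
    qed
    also have "\<dots> = 2 * \<tau>\<^sup>2 * (real p * 2 ^ (k + 4 * b - (b + 7)))"
    proof -
      have "(2::real) ^ (k + 4 * b - (b + 7)) = 2 ^ (k + 4 * b) / 2 ^ (b + 7)"
        using b by (intro power_diff) auto
      then show ?thesis by simp
    qed
    finally show "real (2 ^ (k + b + 1)) \<le> 2 * \<tau>\<^sup>2 * (real p * 2 ^ (k + 4 * b - (b + 7)))" .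
  qed
  have "k ^ (b div 15) \<le> (k + 4 * b - (b + 7)) ^ (b div 15)" using b by (intro power_mono) auto
  also have "\<dots> \<le> 4 * (q * (q - 1) * (4 * b) ^ (b div 15))"
    using b \<tau> by (intro tolerant_tester_query_bound[OF _ _ _ n p_le' sum_binomial_le_two_power yes no _ large tester queries])
      (auto simp: div_greater_zero_iff)
  finally show ?thesis .
qed

section \<open>Conversion of the query bounds to the closed form\<close>

text \<open>The exponent stays below \<open>1 / 11\<close>, and
  \<open>360 \<le> 2 ^ 9 \<le> q ^ 9\<close> yields \<open>k \<le> q ^ 11\<close>.\<close>

lemma powr_le_large_gap:
  fixes l :: real and k q :: nat
  assumes l: "1 \<le> l" "l < 600" and "l \<le> k" "2 \<le> q" "k \<le> 360 * q\<^sup>2"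
  shows "(k / l) powr (1 / 6600 * l) \<le> q"
proof -
  have "1 \<le> k / l" using assms by simp
  then have "(k / l) powr (1 / 6600 * l) \<le> (k / l) powr (1 / 11)" using l by (intro powr_mono) auto
  also have "\<dots> \<le> real k powr (1 / 11)"
    using assms by (intro powr_mono2) (auto simp: pos_divide_le_eq mult_le_cancel_left1)
  also have "\<dots> \<le> real (q ^ 11) powr (1 / 11)"
  proof (intro powr_mono2)
    have "k \<le> 2 ^ 9 * q\<^sup>2" using assms by simp
    also have "\<dots> \<le> q ^ 9 * q\<^sup>2" using assms by (intro mult_right_mono power_mono) auto
    also have "\<dots> = q ^ 11" by (simp flip: power_add)
    finally show "real k \<le> real (q ^ 11)" by (simp only: of_nat_le_iff)
  qed auto
  also have "\<dots> = (real q powr real 11) powr (1 / 11)" using assms by (subst powr_realpow) auto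
  also have "\<dots> = q" using assms by (subst powr_powr) simp
  finally show ?thesis .
qed

text \<open>Since \<open>4 * b \<le> l / 5\<close>, a factor \<open>5 ^ d\<close> is left to absorb
  the constant 4, so \<open>(k / l) ^ d \<le> q\<^sup>2\<close>. The exponent \<open>d / 2\<close>
  is at least \<open>b / 60\<close>, well above \<open>l / 6600\<close>.\<close>

lemma powr_le_small_gap:
  fixes l :: real and b k q :: nat
  assumes b: "30 \<le> b" "20 * b \<le> l" "l < 20 * real b + 20" and "l \<le> k"
    and bound: "k ^ (b div 15) \<le> 4 * (q * (q - 1) * (4 * b) ^ (b div 15))"
  shows "(k / l) powr (1 / 6600 * l) \<le> q"
proof -
  define d where "d = b div 15"
  have d: "2 \<le> d" "real b / 30 \<le> d" using b(1) unfolding d_def by linarith+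
  have l: "0 < l" using b by linarith
  have base: "1 \<le> k / l" using assms(4) l by simp
  have "real (k ^ d) \<le> real (4 * (q * (q - 1) * (4 * b) ^ d))"
    using bound by (simp only: d_def of_nat_le_iff)
  also have "\<dots> \<le> real (4 * (q * q * (4 * b) ^ d))"
    by (simp only: of_nat_le_iff) (intro mult_le_mono order_refl, simp)
  also have "\<dots> = 4 * real q ^ 2 * (4 * real b) ^ d" by (simp add: power2_eq_square)
  also have "\<dots> \<le> 5 ^ d * real q ^ 2 * (l / 5) ^ d"
  proof (intro mult_mono power_mono)
    have "(5::real) ^ 2 \<le> 5 ^ d" using d by (intro power_increasing) auto
    then show "(4::real) \<le> 5 ^ d" by simp
  qed (use b in auto)
  also have "\<dots> = real q ^ 2 * l ^ d" by (simp add: power_divide)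
  finally have "(k / l) ^ d \<le> real q ^ 2" using l by (simp add: power_divide pos_divide_le_eq)
  then have "(k / l) powr d \<le> real q ^ 2" using base by (subst powr_realpow) auto
  then have "((k / l) powr d) powr (1 / 2) \<le> (real q ^ 2) powr (1 / 2)"
    by (intro powr_mono2) auto
  then have "(k / l) powr (d / 2) \<le> q" by (simp add: powr_powr powr_half_sqrt)
  moreover have "(k / l) powr (1 / 6600 * l) \<le> (k / l) powr (d / 2)"
  proof (intro powr_mono base)
    have "30 \<le> real b" using b(1) by simp
    then show "1 / 6600 * l \<le> d / 2" using b(3) d(2) by linarith
  qed
  ultimately show ?thesis by linarith
qed

theorem theorem10:
  fixes C :: real
  assumes "C > 0"
  shows "\<exists>c>0. \<forall>(k::nat) (\<epsilon>\<^sub>1::real) (\<epsilon>\<^sub>2::real).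
    1 / 100 \<le> \<epsilon>\<^sub>1 \<and> \<epsilon>\<^sub>1 < \<epsilon>\<^sub>2 \<and> \<epsilon>\<^sub>2 \<le> 49 / 100 \<and> \<epsilon>\<^sub>2 - \<epsilon>\<^sub>1 \<ge> 2 powr (- (C * real k)) \<longrightarrow>
    (\<exists>N. \<forall>n\<ge>N. \<forall>T.
      tolerant_junta_tester n k (k + nat \<lfloor>- log 2 (\<epsilon>\<^sub>2 - \<epsilon>\<^sub>1) / 20\<rfloor>) \<epsilon>\<^sub>1 \<epsilon>\<^sub>2 T \<longrightarrow>
      makes_at_least_queries T
        ((real k / (- log 2 (\<epsilon>\<^sub>2 - \<epsilon>\<^sub>1))) powr (- (c * log 2 (\<epsilon>\<^sub>2 - \<epsilon>\<^sub>1)))))"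
\<comment> \<open>The constant \<open>6600 = 600 * 11\<close> is dictated by the case
  \<open>b < 30\<close>, where \<open>l < 600\<close> and the exponent has to stay below
  \<open>1 / 11\<close>.\<close>
proof (intro exI[of _ "1 / 6600"] conjI allI impI)
  fix k :: nat and \<epsilon>\<^sub>1 \<epsilon>\<^sub>2 :: real
  assume "1 / 100 \<le> \<epsilon>\<^sub>1 \<and> \<epsilon>\<^sub>1 < \<epsilon>\<^sub>2 \<and> \<epsilon>\<^sub>2 \<le> 49 / 100 \<and> \<epsilon>\<^sub>2 - \<epsilon>\<^sub>1 \<ge> 2 powr (- (C * real k))"
  then have \<epsilon>: "1 / 100 \<le> \<epsilon>\<^sub>1" "\<epsilon>\<^sub>1 < \<epsilon>\<^sub>2" "\<epsilon>\<^sub>2 \<le> 49 / 100" by auto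
  define l where "l = - log 2 (\<epsilon>\<^sub>2 - \<epsilon>\<^sub>1)"
  define b where "b = nat \<lfloor>l / 20\<rfloor>"
  have gap: "\<epsilon>\<^sub>2 - \<epsilon>\<^sub>1 = 2 powr (- l)" using \<epsilon> by (simp add: l_def)
  have l1: "1 \<le> l"
  proof -
    have "log 2 (\<epsilon>\<^sub>2 - \<epsilon>\<^sub>1) \<le> log 2 (1 / 2)" using \<epsilon> by (subst log_le_cancel_iff) auto
    then show ?thesis by (simp add: l_def log_divide)
  qed
  have b: "20 * b \<le> l" "l < 20 * real b + 20"
  proof -
    have "real b = of_int \<lfloor>l / 20\<rfloor>" using l1 by (simp add: b_def)
    then show "20 * b \<le> l" "l < 20 * real b + 20" by linarith+
  qed
  show "\<exists>N. \<forall>n\<ge>N. \<forall>T.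
      tolerant_junta_tester n k (k + nat \<lfloor>- log 2 (\<epsilon>\<^sub>2 - \<epsilon>\<^sub>1) / 20\<rfloor>) \<epsilon>\<^sub>1 \<epsilon>\<^sub>2 T \<longrightarrow>
      makes_at_least_queries T
        ((real k / (- log 2 (\<epsilon>\<^sub>2 - \<epsilon>\<^sub>1))) powr (- (1 / 6600 * log 2 (\<epsilon>\<^sub>2 - \<epsilon>\<^sub>1))))"
  \<comment> \<open>Enough coordinates for both sizes \<open>b + 60\<close> and \<open>4 * b\<close>
    of the hidden set.\<close>
  proof (intro exI[of _ "k + 4 * b + 60"] allI impI)
    fix n T
    assume n: "k + 4 * b + 60 \<le> n"
      and "tolerant_junta_tester n k (k + nat \<lfloor>- log 2 (\<epsilon>\<^sub>2 - \<epsilon>\<^sub>1) / 20\<rfloor>) \<epsilon>\<^sub>1 \<epsilon>\<^sub>2 T"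
    then have tester: "tolerant_junta_tester n k (k + b) \<epsilon>\<^sub>1 \<epsilon>\<^sub>2 T" by (simp add: b_def l_def)
    define Q where "Q = (k / l) powr (1 / 6600 * l)"
    have "makes_at_least_queries T Q"
    proof (rule ccontr)
      assume "\<not> ?thesis"
      then have less: "real (num_queries t f) < Q" if "t \<in> set_pmf T" for t f
        using that by (meson makes_at_least_queries_def not_le)
      \<comment> \<open>The largest integer strictly below \<open>Q\<close>; the contradiction will
        be \<open>Q \<le> q\<close>.\<close>
      define q where "q = nat (\<lceil>Q\<rceil> - 1)"
      obtain t where "t \<in> set_pmf T" using set_pmf_not_empty by fast
      then have "0 < Q" using less[of t undefined] by linarith
      then have qQ: "real q < Q" unfolding q_def by linarith
      have queries: "num_queries t f \<le> q" if "t \<in> set_pmf T" for t f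
        using less[OF that, of f] unfolding q_def by linarith
      have first: "k + b + 60 \<le> 4 * (q * (q - 1) * (b + 60))"
        using query_bound_large_gap[OF _ \<epsilon>(3) _ tester queries] \<epsilon> n by simp
      \<comment> \<open>For \<open>q \<le> 1\<close> the factor \<open>q * (q - 1)\<close> vanishes,
        contrary to \<open>first\<close>.\<close>
      have q2: "2 \<le> q"
      proof (rule ccontr)
        assume "\<not> 2 \<le> q"
        then have "q * (q - 1) = 0" by (cases q) auto
        with first have "k + b + 60 \<le> 4 * (0 * (b + 60))" by (simp only:)
        then show False by simp
      qed
      have "Q \<le> q"
      proof (cases "l \<le> k")
        case False
        \<comment> \<open>The base \<open>k / l\<close> is below 1, so the claimed bound is
          trivial.\<close>
        then have "Q \<le> 1" using l1 unfolding Q_def by (intro powr_le1) auto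
        then show ?thesis using q2 by linarith
      next
        case lk: True
        show ?thesis
        proof (cases "30 \<le> b")
          case True
          have "(2::real) powr (- l) \<le> 2 powr (- real (b + 10))"
            using b True by (intro powr_mono) auto
          then have "\<epsilon>\<^sub>2 - \<epsilon>\<^sub>1 \<le> 1 / 2 ^ (b + 10)"
            unfolding gap by (simp only: powr_minus powr_realpow zero_less_numeral inverse_eq_divide)
          moreover have "20 * b \<le> k" using b lk by linarith
          ultimately have "k ^ (b div 15) \<le> 4 * (q * (q - 1) * (4 * b) ^ (b div 15))"
            using query_bound_small_gap[OF \<epsilon>(1) _ \<epsilon>(3) _ True _ _ tester queries] \<epsilon> n by simp
          then show ?thesis unfolding Q_def by (intro powr_le_small_gap[OF True b lk])
        next
          case False
          then have "4 * (q * (q - 1) * (b + 60)) \<le> 4 * (q * q * 90)"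
            by (intro mult_le_mono) auto
          moreover have "4 * (q * q * 90) = 360 * q\<^sup>2" by (simp add: power2_eq_square)
          ultimately have "k \<le> 360 * q\<^sup>2" using first by linarith
          moreover have "l < 600" using b False by linarith
          ultimately show ?thesis unfolding Q_def by (intro powr_le_large_gap[OF l1 _ lk q2])
        qed
      qed
      then show False using qQ by simp
    qed
    then show "makes_at_least_queries T
        ((real k / (- log 2 (\<epsilon>\<^sub>2 - \<epsilon>\<^sub>1))) powr (- (1 / 6600 * log 2 (\<epsilon>\<^sub>2 - \<epsilon>\<^sub>1))))"
      by (simp add: Q_def l_def)
  qed
qed simp

end
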